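(* For every $p\in[1,\infty]$: 1. $R_{\min}^{\mathrm{CN}}(p)\le R_c^{\mathrm{CN}}(p)\le\left\|\left(1,\frac32\right)\right\|_p$; 2. $\sqrt{2-\sqrt2}\le R_c^{\mathrm{NN}}(p)\le\left\|\left(1,\frac32\right)\right\|_p$.
   Context: Norms: for $Q=(x,y)\in\mathbb{R}^2$, $\|Q\|_p=(|x|^p+|y|^p)^{1/p}$ if $p\in[1,\infty)$ and $\|Q\|_\infty=\max\{|x|,|y|\}$. Point collections: $\mathcal{P}=\prod_{(i,j)\in\mathbb{Z}^2}[i,i+1]\times[j,j+1]$. An element is a family $P=(P_{i,j})_{(i,j)\in\mathbb{Z}^2}$ with $P_{i,j}\in[i,i+1]\times[j,j+1]$. The probability measure $\mathbb{P}=\bigotimes_{(i,j)\in\mathbb{Z}^2}\mathcal{U}([i,i+1]\times[j,j+1])$ on $\mathcal{P}$ is the product of uniform distributions: the points $P_{i,j}$ are independent and $P_{i,j}$ is uniform on $[i,i+1]\times[j,j+1]$. Complete neighbor model: for $P\in\mathcal{P}$ and $R>0$, $\Gamma_{p,R}^{\mathrm{CN}}(P)$ is the undirected graph with vertex set $\mathbb{Z}^2$ and edge set $E_{p,R}^{\mathrm{CN}}(P)=\{(u,v)\in\mathbb{Z}^2\times\mathbb{Z}^2: u\neq v,\ \|P_u-P_v\|_p\le R\}$. Nearest neighbor model: $\Gamma_{p,R}^{\mathrm{NN}}(P)$ is the undirected graph with vertex set $\mathbb{Z}^2$ and edge set $E_{p,R}^{\mathrm{NN}}(P)=E_{p,R}^{\mathrm{CN}}(P)\cap\{(u,v):\|u-v\|_1=1\}$.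 For a graph $G$ on $\mathbb{Z}^2$, $\mathcal{C}_0(G)$ is the connected component of $(0,0)$, i.e. the set of vertices connected to $(0,0)$ by a finite path of $G$. For $\ast\in\{\mathrm{CN},\mathrm{NN}\}$: the percolation probability is $\theta_p^{\ast}(R)=\mathbb{P}(|\mathcal{C}_0(\Gamma_{p,R}^{\ast}(P))|=\infty)$; the critical radius is $R_c^{\ast}(p)=\sup\{R>0:\theta_p^{\ast}(R)=0\}$; the possible connectivity radius is $R_{\min}^{\ast}(p)=\inf\{R>0:\ \exists P\in\mathcal{P},\ |\mathcal{C}_0(\Gamma_{p,R}^{\ast}(P))|=\infty\}$. *)

theory Defs
  imports "HOL-Probability.Probability"
begin

definition lp_norm :: "ereal \<Rightarrow> real \<times> real \<Rightarrow> real" where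
  "lp_norm p Q =
     (if p = \<infinity> then max \<bar>fst Q\<bar> \<bar>snd Q\<bar>
      else (\<bar>fst Q\<bar> powr real_of_ereal p + \<bar>snd Q\<bar> powr real_of_ereal p) powr (1 / real_of_ereal p))"

type_synonym vertex = "int \<times> int"

definition cell :: "vertex \<Rightarrow> (real \<times> real) set" where
  "cell u = {of_int (fst u) .. of_int (fst u) + 1} \<times> {of_int (snd u) .. of_int (snd u) + 1}"

definition point_collections :: "(vertex \<Rightarrow> real \<times> real) set" where
  "point_collections = (\<Pi>\<^sub>E u\<in>UNIV. cell u)"

text \<open>The uniform distribution on a cell is taken as a measure whose underlying space is the cell
  itself, so that the product measure lives on \<^const>\<open>point_collections\<close>.\<close>

definition uniform_cell :: "vertex \<Rightarrow> (real \<times> real) measure" where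
  "uniform_cell u = uniform_measure (restrict_space lborel (cell u)) (cell u)"

definition collection_measure :: "(vertex \<Rightarrow> real \<times> real) measure" where
  "collection_measure = (\<Pi>\<^sub>M u\<in>UNIV. uniform_cell u)"

datatype neighbor_model = CN | NN

text \<open>Both edge relations are symmetric; an undirected graph with vertex set
  \<^typ>\<open>vertex\<close> is represented by its symmetric edge relation.\<close>

definition cn_edges :: "ereal \<Rightarrow> real \<Rightarrow> (vertex \<Rightarrow> real \<times> real) \<Rightarrow> (vertex \<times> vertex) set" where
  "cn_edges p R P = {(u, v). u \<noteq> v \<and> lp_norm p (P u - P v) \<le> R}"

definition nn_edges :: "ereal \<Rightarrow> real \<Rightarrow> (vertex \<Rightarrow> real \<times> real) \<Rightarrow> (vertex \<times> vertex) set" where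
  "nn_edges p R P =
     cn_edges p R P \<inter> {(u, v). lp_norm 1 (of_int (fst u - fst v), of_int (snd u - snd v)) = 1}"

fun edges :: "neighbor_model \<Rightarrow> ereal \<Rightarrow> real \<Rightarrow> (vertex \<Rightarrow> real \<times> real) \<Rightarrow> (vertex \<times> vertex) set" where
  "edges CN = cn_edges"
| "edges NN = nn_edges"

definition origin_component :: "(vertex \<times> vertex) set \<Rightarrow> vertex set" where
  "origin_component E = {v. ((0, 0), v) \<in> E\<^sup>*}"

definition percolation_prob :: "neighbor_model \<Rightarrow> ereal \<Rightarrow> real \<Rightarrow> real" where
  "percolation_prob m p R =
     measure collection_measure
       {P \<in> space collection_measure. infinite (origin_component (edges m p R P))}"

text \<open>The radii are extended reals, so that the supremum of an unbounded set and the infimum of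
  the empty set are \<^term>\<open>\<infinity>\<close> instead of unspecified reals.\<close>

definition critical_radius :: "neighbor_model \<Rightarrow> ereal \<Rightarrow> ereal" where
  "critical_radius m p = (SUP R\<in>{R. R > 0 \<and> percolation_prob m p R = 0}. ereal R)"

definition min_radius :: "neighbor_model \<Rightarrow> ereal \<Rightarrow> ereal" where
  "min_radius m p =
     (INF R\<in>{R. R > 0 \<and> (\<exists>P\<in>point_collections. infinite (origin_component (edges m p R P)))}. ereal R)"

lemma sym_edges: "sym (edges m p R P)"
  by (cases m) (auto simp: cn_edges_def nn_edges_def sym_def lp_norm_def abs_minus_commute)

lemma cell_borel [measurable]: "cell u \<in> sets borel"
  unfolding cell_def by (intro borel_closed closed_Times) auto

lemma emeasure_cell: "emeasure lborel (cell u) = 1"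
proof -
  have "emeasure lborel (cell u) = emeasure (lborel \<Otimes>\<^sub>M lborel) (cell u)"
    by (simp add: lborel_prod)
  also have "\<dots> = 1"
    unfolding cell_def by (subst lborel.emeasure_pair_measure_Times) auto
  finally show ?thesis .
qed

lemma prob_space_uniform_cell: "prob_space (uniform_cell u)"
  unfolding uniform_cell_def
  by (rule prob_space_uniform_measure) (simp_all add: emeasure_restrict_space emeasure_cell)

lemma prob_space_collection_measure: "prob_space collection_measure"
  unfolding collection_measure_def by (intro prob_space_PiM prob_space_uniform_cell)

lemma space_collection_measure: "space collection_measure = point_collections"
  by (simp add: collection_measure_def point_collections_def uniform_cell_def space_PiM
      space_restrict_space)

lemma point_measurable [measurable]: "(\<lambda>P. P u) \<in> borel_measurable collection_measure"
proof -
  have "(\<lambda>x. x) \<in> uniform_cell u \<rightarrow>\<^sub>M borel"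
    unfolding uniform_cell_def
    by (subst measurable_cong_sets[OF sets_uniform_measure refl])
      (simp add: measurable_restrict_space1)
  moreover have "(\<lambda>P. P u) \<in> collection_measure \<rightarrow>\<^sub>M uniform_cell u"
    unfolding collection_measure_def by (rule measurable_component_singleton) simp
  ultimately show ?thesis
    using measurable_compose by blast
qed

lemma lp_norm_measurable [measurable]: "lp_norm p \<in> borel_measurable borel"
proof -
  have [measurable]: "fst \<in> borel_measurable (borel :: (real \<times> real) measure)"
    "snd \<in> borel_measurable (borel :: (real \<times> real) measure)"
    by (intro borel_measurable_continuous_onI continuous_intros)+
  show ?thesis
    unfolding lp_norm_def[abs_def] by measurable
qed

lemma edges_measurable [measurable]:
  "Measurable.pred collection_measure (\<lambda>P. (u, v) \<in> edges m p R P)"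
  by (cases m) (simp_all add: cn_edges_def nn_edges_def)

lemma origin_component_measurable [measurable]:
  "Measurable.pred collection_measure (\<lambda>P. v \<in> origin_component (edges m p R P))"
proof -
  have [measurable]: "Measurable.pred collection_measure (\<lambda>P. (u, v) \<in> edges m p R P ^^ n)" for u v n
    by (induction n arbitrary: v) (simp_all add: relcomp_unfold)
  show ?thesis
    unfolding origin_component_def rtrancl_power mem_Collect_eq by measurable
qed

lemma percolation_event_measurable:
  "{P \<in> space collection_measure. infinite (origin_component (edges m p R P))}
     \<in> sets collection_measure"
proof -
  have "infinite S \<longleftrightarrow> (\<forall>xs :: vertex list. \<exists>v. v \<notin> set xs \<and> v \<in> S)" for S
    by (metis List.finite_set finite_list finite_subset subsetI)
  then show ?thesis
    by simp
qed

end

theory Submission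
  imports Defs
begin

text \<open>Let \<open>a\<close>, \<open>b\<close> be the offsets of a point in its unit cell. An open horizontal edge forces the offset
  \<open>a\<close> to drop by at least \<open>1 - R\<close> along it. If \<open>R\<close> is at least the norm of \<open>(1, 3/2)\<close>, a closed one forces
  \<open>a\<close> to rise by at least \<open>1/2\<close>. Vertical edges behave in the same way with \<open>b\<close>. For distinct edges these
  gap events are independent or negatively correlated, so \<open>n\<close> prescribed gaps of size \<open>s\<close> have probability
  at most \<open>((1 - s)\<^sup>2 / 2) ^ n\<close>.

  For the lower bound take \<open>R = 4/5\<close>, which exceeds \<open>sqrt (2 - sqrt 2)\<close>: there are at most \<open>4 * 3 ^ n\<close>
  self-avoiding paths of length \<open>n + 1\<close> from the origin, each open with probability at most \<open>(8/25) ^ (n + 1)\<close>,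
  and \<open>3 * 8/25 < 1\<close>.

  The upper bound is a Peierls argument. If the origin has a finite component whose rightmost vertex on the
  horizontal axis is \<open>(k, 0)\<close>, then following boundary edges of the component across unit squares leads from
  the edge \<open>(k, 0), (k + 1, 0)\<close> to the vertical axis, which takes at least \<open>k + 2\<close> distinct closed
  edges. Each edge shares a square with six others, so the origin has a finite component with probability at
  most the sum of \<open>6 ^ (k + 1) / 8 ^ (k + 2)\<close>, which is \<open>3/8\<close>.

  In the complete neighbor model no configuration percolates for \<open>R = 1/25\<close>: a self-avoiding path of 26
  vertices would have to fit into 25 cells. Hence the critical radius is positive, and below the possible
  connectivity radius the percolation event is empty.\<close>

subsection \<open>Gaps between independent uniform variables\<close>

abbreviation unit_uniform :: "real measure" where
  "unit_uniform \<equiv> uniform_measure lborel {0..1}"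

declare emeasure_uniform_measure [simp del]

lemma prob_space_unit_uniform: "prob_space unit_uniform"
  by (rule prob_space_uniform_measure) simp_all

lemma nn_integral_unit_uniform:
  "f \<in> borel_measurable borel \<Longrightarrow>
     (\<integral>\<^sup>+x. f x \<partial>unit_uniform) = (\<integral>\<^sup>+x. f x * indicator {0..1} x \<partial>lborel)"
  by (subst nn_integral_uniform_measure) (auto simp: divide_ennreal_def)

lemma emeasure_unit_uniform:
  "A \<in> sets borel \<Longrightarrow> emeasure unit_uniform A = emeasure lborel ({0..1} \<inter> A)"
  by (simp add: emeasure_uniform_measure divide_ennreal_def)

lemma emeasure_unit_uniform_atMost: "emeasure unit_uniform {..t} = ennreal (min 1 t)"
proof -
  have "{0..1} \<inter> {..t} = {0..min 1 t}" by auto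
  then show ?thesis
    by (cases "0 \<le> min 1 t") (auto simp: emeasure_unit_uniform ennreal_neg)
qed

text \<open>With g the indicator of \<open>D\<close>, integrate the pointwise inequality (g x - g
  y)(f x - f y) \<le> 0 over two independent copies of \<open>M\<close>. It is written additively
  because subtraction truncates in \<open>ennreal\<close>.\<close>

lemma Chebyshev_antitone_indicator:
  fixes f :: "real \<Rightarrow> ennreal" and D :: "real set"
  assumes "prob_space M" and [measurable_cong]: "sets M = sets borel"
    and [measurable]: "D \<in> sets borel" "f \<in> borel_measurable borel"
    and f: "mono f" and D: "\<And>x y. x \<le> y \<Longrightarrow> y \<in> D \<Longrightarrow> x \<in> D"
  shows "(\<integral>\<^sup>+x. indicator D x * f x \<partial>M) \<le> (\<integral>\<^sup>+x. indicator D x \<partial>M) * (\<integral>\<^sup>+x. f x \<partial>M)"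
proof -
  interpret prob_space M by fact
  let ?g = "indicator D :: real \<Rightarrow> ennreal"
  let ?I = "\<integral>\<^sup>+x. ?g x * f x \<partial>M" and ?J = "(\<integral>\<^sup>+x. ?g x \<partial>M) * (\<integral>\<^sup>+x. f x \<partial>M)"
  have pointwise: "?g x * f x + ?g y * f y \<le> ?g x * f y + ?g y * f x" for x y
  proof (cases "x \<le> y")
    case True
    then show ?thesis using D[of x y] monoD[OF f, of x y] by (auto simp: indicator_def add.commute)
  next
    case False
    then show ?thesis using D[of y x] monoD[OF f, of y x] by (auto simp: indicator_def)
  qed
  have "?I + ?I = (\<integral>\<^sup>+x. \<integral>\<^sup>+y. ?g x * f x + ?g y * f y \<partial>M \<partial>M)"
    by (simp add: nn_integral_add emeasure_space_1)
  also have "\<dots> \<le> (\<integral>\<^sup>+x. \<integral>\<^sup>+y. ?g x * f y + ?g y * f x \<partial>M \<partial>M)"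
    by (intro nn_integral_mono pointwise)
  also have "\<dots> = ?J + ?J"
    by (simp add: nn_integral_add nn_integral_cmult nn_integral_multc del: nn_integral_indicator)
  finally have "2 * ?I \<le> 2 * ?J" by (simp add: mult_2)
  then show ?thesis
    by (simp add: ennreal_mult_le_mult_iff)
qed

text \<open>This is the probability that one uniform variable exceeds an independent one by at least
  \<open>s\<close>: the area of a right triangle with legs 1 - s.\<close>

lemma emeasure_gap:
  assumes "0 \<le> s" "s \<le> 1"
  shows "(\<integral>\<^sup>+y. emeasure unit_uniform {..y - s} \<partial>unit_uniform) = ennreal ((1 - s)\<^sup>2 / 2)"
proof -
  \<comment> \<open>On the unit interval \<open>y - s\<close> never exceeds 1, and for
    \<open>y < s\<close> both sides vanish because \<open>ennreal\<close> sends negative numbers to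
    0.\<close>
  have *: "ennreal (min 1 (y - s)) * indicator {0..1} y = ennreal (y - s) * indicator {s..1} y" for y
    using assms by (auto simp: indicator_def ennreal_neg)
  have "(\<integral>\<^sup>+y. emeasure unit_uniform {..y - s} \<partial>unit_uniform) =
      (\<integral>\<^sup>+y. ennreal (y - s) * indicator {s..1} y \<partial>lborel)"
    unfolding emeasure_unit_uniform_atMost by (subst nn_integral_unit_uniform) (simp_all add: *)
  also have "\<dots> = ennreal ((1 - s)\<^sup>2 / 2 - (s - s)\<^sup>2 / 2)"
    using assms by (intro nn_integral_FTC_Icc) (auto intro!: derivative_eq_intros)
  finally show ?thesis by simp
qed

text \<open>The indicator ignores the space of \<open>M\<close>, so that updated functions can later
  be substituted without membership side conditions.\<close>

lemma emeasure_pred_eq_nn_integral: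
  assumes "Measurable.pred M Q"
  shows "emeasure M {x \<in> space M. Q x} = (\<integral>\<^sup>+x. indicator {x. Q x} x \<partial>M)"
proof -
  have "emeasure M {x \<in> space M. Q x} = (\<integral>\<^sup>+x. indicator {x \<in> space M. Q x} x \<partial>M)"
    using assms by (intro nn_integral_indicator[symmetric]) (auto simp: pred_def)
  also have "\<dots> = (\<integral>\<^sup>+x. indicator {x. Q x} x \<partial>M)"
    by (intro nn_integral_cong) (auto simp: indicator_def)
  finally show ?thesis .
qed

text \<open>Removing a maximal index \<open>i\<close> of \<open>S\<close> decouples its upper variable \<open>\<sigma> i\<close>. Given the rest, the
  remaining constraints on the variable \<open>i\<close> define a down-set, whereas the removed constraint
  becomes more likely as this variable grows, so the two are negatively correlated.\<close>

lemma emeasure_gaps_le: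
  fixes \<sigma> :: "'i \<Rightarrow> 'i"
  assumes inj: "inj \<sigma>" and acyclic: "\<And>S. finite S \<Longrightarrow> S \<noteq> {} \<Longrightarrow> \<exists>i\<in>S. \<sigma> i \<notin> S"
    and s: "0 \<le> s" "s \<le> 1"
    and J: "finite J" "S \<subseteq> J" "\<sigma> ` S \<subseteq> J"
  shows "emeasure (\<Pi>\<^sub>M j\<in>J. unit_uniform) {w \<in> space (\<Pi>\<^sub>M j\<in>J. unit_uniform). \<forall>i\<in>S. w i - w (\<sigma> i) \<ge> s}
    \<le> ennreal ((1 - s)\<^sup>2 / 2) ^ card S"
  using J
proof (induction "card S" arbitrary: S J)
  case 0
  then have "S = {}" using finite_subset by fastforce
  interpret prob_space "\<Pi>\<^sub>M j\<in>J. unit_uniform" by (intro prob_space_PiM prob_space_unit_uniform)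
  show ?case using \<open>S = {}\<close> emeasure_space_1 by simp
next
  case (Suc n)
  interpret U: prob_space unit_uniform by (rule prob_space_unit_uniform)
  interpret product_prob_space "\<lambda>_::'i. unit_uniform" by standard
  define E where "E S w \<longleftrightarrow> (\<forall>i\<in>S. w i - w (\<sigma> i) \<ge> s)" for S and w :: "'i \<Rightarrow> real"
  have fin: "finite S" using Suc.prems finite_subset by blast
  moreover have "S \<noteq> {}" using Suc.hyps by auto
  ultimately obtain i where i: "i \<in> S" "\<sigma> i \<notin> S" using acyclic by metis
  define S' J1 J' where "S' = S - {i}" and "J1 = J - {\<sigma> i}" and "J' = J1 - {i}"
  have ne: "i \<noteq> \<sigma> i" using i by auto
  have S': "S = insert i S'" "finite S'" using i fin by (auto simp: S'_def)
  have J: "J = insert (\<sigma> i) J1" "J1 = insert i J'" "finite J1" "\<sigma> i \<notin> J1" "finite J'" "i \<notin> J'"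
    using Suc.prems i ne by (auto simp: J1_def J'_def)
  \<comment> \<open>By injectivity no other index of \<open>S\<close> is mapped to
    \<open>\<sigma> i\<close>, and \<open>\<sigma> i\<close> is not in \<open>S\<close>, so the
    variable at \<open>\<sigma> i\<close> occurs in the constraint of \<open>i\<close> only.\<close>
  have sub: "S' \<subseteq> J1" "\<sigma> ` S' \<subseteq> J1"
    using Suc.prems i inj by (auto simp: S'_def J1_def inj_eq)
  have \<sigma>i: "j \<noteq> \<sigma> i \<and> \<sigma> j \<noteq> \<sigma> i" if "j \<in> S'" for j
    using that sub J(4) by (metis image_subset_iff subsetD)
  have meas: "Measurable.pred (\<Pi>\<^sub>M j\<in>K. unit_uniform) (E T)"
    if "finite T" "T \<subseteq> K" "\<sigma> ` T \<subseteq> K" for T K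
  proof -
    have comp: "(\<lambda>w. w j) \<in> borel_measurable (\<Pi>\<^sub>M j\<in>K. unit_uniform)" if "j \<in> K" for j
      by (rule measurable_compose[OF measurable_component_singleton[OF that]]) (simp add: measurable_ident_sets)
    show ?thesis
      unfolding E_def
    proof (intro pred_intros_finite that(1))
      fix j assume "j \<in> T"
      then have [measurable]: "(\<lambda>w. w j) \<in> borel_measurable (\<Pi>\<^sub>M j\<in>K. unit_uniform)"
        "(\<lambda>w. w (\<sigma> j)) \<in> borel_measurable (\<Pi>\<^sub>M j\<in>K. unit_uniform)"
        using that by (auto intro: comp)
      show "Measurable.pred (\<Pi>\<^sub>M j\<in>K. unit_uniform) (\<lambda>w. s \<le> w j - w (\<sigma> j))"
        by measurable
    qed
  qed
  have [measurable]: "Measurable.pred (\<Pi>\<^sub>M j\<in>J. unit_uniform) (E S)"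
    "Measurable.pred (\<Pi>\<^sub>M j\<in>J1. unit_uniform) (E S')"
    using meas fin Suc.prems S' sub by auto
  have i': "(\<lambda>w. w i) \<in> borel_measurable (\<Pi>\<^sub>M j\<in>J1. unit_uniform)"
    by (rule measurable_compose[OF measurable_component_singleton]) (auto simp: J(2) measurable_ident_sets)
  let ?h = "\<lambda>y. emeasure unit_uniform {..y - s}"
  let ?g = "\<lambda>w. indicator {w. E S' w} w :: ennreal"
  have split: "E S (w(\<sigma> i := z)) \<longleftrightarrow> E S' w \<and> z \<in> {..w i - s}" for w z
    using \<sigma>i ne unfolding E_def S'(1) by auto
  have "emeasure (\<Pi>\<^sub>M j\<in>J. unit_uniform) {w \<in> space (\<Pi>\<^sub>M j\<in>J. unit_uniform). E S w} =
     (\<integral>\<^sup>+w. indicator {w. E S w} w \<partial>(\<Pi>\<^sub>M j\<in>J. unit_uniform))"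
    by (rule emeasure_pred_eq_nn_integral) measurable
  also have "\<dots> = (\<integral>\<^sup>+w. \<integral>\<^sup>+z. indicator {w. E S w} (w(\<sigma> i := z)) \<partial>unit_uniform \<partial>(\<Pi>\<^sub>M j\<in>J1. unit_uniform))"
    by (rule product_nn_integral_insert[OF J(3,4), folded J(1)]) measurable
  \<comment> \<open>Integrating out the variable at \<open>\<sigma> i\<close> leaves the conditional
    probability of the removed constraint, which depends on \<open>w i\<close> alone.\<close>
  also have "\<dots> = (\<integral>\<^sup>+w. ?g w * ?h (w i) \<partial>(\<Pi>\<^sub>M j\<in>J1. unit_uniform))"
  proof (intro nn_integral_cong)
    fix w
    have "(\<integral>\<^sup>+z. indicator {w. E S w} (w(\<sigma> i := z)) \<partial>unit_uniform) =
       (\<integral>\<^sup>+z. ?g w * indicator {..w i - s} z \<partial>unit_uniform)"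
      by (intro nn_integral_cong) (simp add: indicator_def split)
    then show "(\<integral>\<^sup>+z. indicator {w. E S w} (w(\<sigma> i := z)) \<partial>unit_uniform) = ?g w * ?h (w i)"
      by (simp add: nn_integral_cmult)
  qed
  also have "\<dots> = (\<integral>\<^sup>+w. \<integral>\<^sup>+y. ?g (w(i := y)) * ?h y \<partial>unit_uniform \<partial>(\<Pi>\<^sub>M j\<in>J'. unit_uniform))"
    by (subst product_nn_integral_insert[OF J(5,6), folded J(2)])
      (use i' in \<open>simp_all add: emeasure_unit_uniform_atMost\<close>)
  also have "\<dots> \<le> (\<integral>\<^sup>+w. (\<integral>\<^sup>+y. ?g (w(i := y)) \<partial>unit_uniform) * ennreal ((1 - s)\<^sup>2 / 2) \<partial>(\<Pi>\<^sub>M j\<in>J'. unit_uniform))"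
  proof (intro nn_integral_mono)
    fix w assume w: "w \<in> space (\<Pi>\<^sub>M j\<in>J'. unit_uniform)"
    let ?D = "{y. E S' (w(i := y))}"
    have "(\<lambda>y. w(i := y)) \<in> unit_uniform \<rightarrow>\<^sub>M (\<Pi>\<^sub>M j\<in>J1. unit_uniform)"
      using w J(2) by (intro measurable_fun_upd[where J = J']) auto
    then have "Measurable.pred unit_uniform (\<lambda>y. E S' (w(i := y)))"
      by (rule measurable_compose) fact
    then have D: "?D \<in> sets borel" by (simp add: pred_def)
    have "(\<integral>\<^sup>+y. indicator ?D y * ?h y \<partial>unit_uniform) \<le>
        (\<integral>\<^sup>+y. indicator ?D y \<partial>unit_uniform) * (\<integral>\<^sup>+y. ?h y \<partial>unit_uniform)"
    proof (rule Chebyshev_antitone_indicator[OF prob_space_unit_uniform _ D])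
      show "mono ?h" by (intro monoI emeasure_mono) auto
      fix x y assume xy: "x \<le> y" "y \<in> ?D"
      \<comment> \<open>As \<open>i\<close> is not in \<open>S'\<close>, its variable can only occur
        subtracted, so lowering it preserves the remaining constraints.\<close>
      have "s \<le> (w(i := x)) j - (w(i := x)) (\<sigma> j)" if "j \<in> S'" for j
      proof -
        have "s \<le> (w(i := y)) j - (w(i := y)) (\<sigma> j)" "j \<noteq> i"
          using xy(2) that by (auto simp: E_def S'_def)
        then show ?thesis using xy(1) by (cases "\<sigma> j = i") auto
      qed
      then show "x \<in> ?D" by (simp add: E_def)
    qed (simp_all add: emeasure_unit_uniform_atMost)
    then show "(\<integral>\<^sup>+y. ?g (w(i := y)) * ?h y \<partial>unit_uniform) \<le>
        (\<integral>\<^sup>+y. ?g (w(i := y)) \<partial>unit_uniform) * ennreal ((1 - s)\<^sup>2 / 2)"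
      by (simp add: emeasure_gap s indicator_def)
  qed
  also have "\<dots> = (\<integral>\<^sup>+w. \<integral>\<^sup>+y. ?g (w(i := y)) \<partial>unit_uniform \<partial>(\<Pi>\<^sub>M j\<in>J'. unit_uniform)) * ennreal ((1 - s)\<^sup>2 / 2)"
  proof (intro nn_integral_multc)
    have "(\<lambda>(w, y). w(i := y)) \<in> (\<Pi>\<^sub>M j\<in>J'. unit_uniform) \<Otimes>\<^sub>M unit_uniform \<rightarrow>\<^sub>M (\<Pi>\<^sub>M j\<in>J1. unit_uniform)"
      unfolding J(2) by (rule measurable_add_dim)
    note [measurable] = this[unfolded case_prod_beta']
    have "(\<lambda>x. ?g ((fst x)(i := snd x))) \<in> borel_measurable ((\<Pi>\<^sub>M j\<in>J'. unit_uniform) \<Otimes>\<^sub>M unit_uniform)"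
      by (rule measurable_compose[of "\<lambda>x. (fst x)(i := snd x)" _ "\<Pi>\<^sub>M j\<in>J1. unit_uniform"]) measurable
    then show "(\<lambda>w. \<integral>\<^sup>+y. ?g (w(i := y)) \<partial>unit_uniform) \<in> borel_measurable (\<Pi>\<^sub>M j\<in>J'. unit_uniform)"
      by (intro U.borel_measurable_nn_integral) (simp add: case_prod_beta')
  qed
  also have "(\<integral>\<^sup>+w. \<integral>\<^sup>+y. ?g (w(i := y)) \<partial>unit_uniform \<partial>(\<Pi>\<^sub>M j\<in>J'. unit_uniform)) =
      (\<integral>\<^sup>+w. ?g w \<partial>(\<Pi>\<^sub>M j\<in>J1. unit_uniform))"
    by (rule product_nn_integral_insert[OF J(5,6), folded J(2), symmetric]) measurable
  also have "\<dots> = emeasure (\<Pi>\<^sub>M j\<in>J1. unit_uniform) {w \<in> space (\<Pi>\<^sub>M j\<in>J1. unit_uniform). E S' w}"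
    by (rule emeasure_pred_eq_nn_integral[symmetric]) measurable
  also have "\<dots> \<le> ennreal ((1 - s)\<^sup>2 / 2) ^ card S'"
    unfolding E_def using Suc.hyps(2) sub J(3) i fin by (intro Suc.hyps(1)) (auto simp: S'_def)
  finally have "emeasure (\<Pi>\<^sub>M j\<in>J. unit_uniform) {w \<in> space (\<Pi>\<^sub>M j\<in>J. unit_uniform). E S w}
      \<le> ennreal ((1 - s)\<^sup>2 / 2) ^ card S' * ennreal ((1 - s)\<^sup>2 / 2)"
    by (simp add: mult_right_mono)
  moreover have "card S = Suc (card S')"
    unfolding S'_def by (rule card.remove[OF fin i(1)])
  ultimately show ?case
    unfolding E_def by (simp only: power_Suc2)
qed

section \<open>Offsets of the points as independent uniform variables\<close>

definition offset :: "vertex \<times> bool \<Rightarrow> (vertex \<Rightarrow> real \<times> real) \<Rightarrow> real" where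
  "offset j P = (if snd j then snd (P (fst j)) - of_int (snd (fst j))
                 else fst (P (fst j)) - of_int (fst (fst j)))"

lemma offset_measurable [measurable]: "offset j \<in> borel_measurable collection_measure"
proof -
  have [measurable]: "fst \<in> borel_measurable (borel :: (real \<times> real) measure)"
    "snd \<in> borel_measurable (borel :: (real \<times> real) measure)"
    by (intro borel_measurable_continuous_onI continuous_intros)+
  show ?thesis unfolding offset_def[abs_def] by measurable
qed

lemma emeasure_lborel_shift:
  fixes c :: real
  assumes [measurable]: "A \<in> sets borel"
  shows "emeasure lborel {x \<in> {c..c + 1}. x - c \<in> A} = emeasure unit_uniform A"
proof -
  have "emeasure lborel {x \<in> {c..c + 1}. x - c \<in> A} =
      emeasure (distr lborel borel ((+) c)) {x \<in> {c..c + 1}. x - c \<in> A}"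
    by (simp add: lborel_distr_plus)
  also have "\<dots> = emeasure lborel ((+) c -` {x \<in> {c..c + 1}. x - c \<in> A})"
    by (subst emeasure_distr) auto
  also have "(+) c -` {x \<in> {c..c + 1}. x - c \<in> A} = {0..1} \<inter> A"
    by auto
  finally show ?thesis by (simp add: emeasure_unit_uniform)
qed

text \<open>A cell has area 1, so its uniform measure is Lebesgue measure restricted to it and
  factorises on rectangles: the two offsets of a point are independent and uniform.\<close>

lemma uniform_cell_Times:
  fixes u :: vertex
  assumes [measurable]: "A \<in> sets borel" "B \<in> sets borel"
  defines "X \<equiv> {q \<in> cell u. fst q - of_int (fst u) \<in> A \<and> snd q - of_int (snd u) \<in> B}"
  shows "X \<in> sets (uniform_cell u)"
    and "emeasure (uniform_cell u) X = emeasure unit_uniform A * emeasure unit_uniform B"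
proof -
  let ?A = "{x \<in> {of_int (fst u)..of_int (fst u) + 1}. x - of_int (fst u) \<in> A}"
  let ?B = "{x \<in> {of_int (snd u)..of_int (snd u) + 1}. x - of_int (snd u) \<in> B}"
  have X: "X = ?A \<times> ?B" by (auto simp: X_def cell_def)
  have AB: "?A \<in> sets borel" "?B \<in> sets borel" by measurable
  have *: "X \<in> sets lborel" "X \<subseteq> cell u"
    using AB by (auto simp: X cell_def simp flip: lborel_prod)
  then show sets: "X \<in> sets (uniform_cell u)"
    by (auto simp: uniform_cell_def sets_restrict_space)
  have "emeasure (uniform_cell u) X = emeasure lborel X"
    using * unfolding uniform_cell_def
    by (subst emeasure_uniform_measure)
      (auto simp: sets_restrict_space emeasure_restrict_space emeasure_cell divide_ennreal_def
        Int_absorb1)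
  also have "\<dots> = emeasure (lborel \<Otimes>\<^sub>M lborel) (?A \<times> ?B)"
    by (simp add: lborel_prod X)
  also have "\<dots> = emeasure unit_uniform A * emeasure unit_uniform B"
    using AB by (subst lborel.emeasure_pair_measure_Times)
      (simp_all only: emeasure_lborel_shift assms sets_lborel)
  finally show "emeasure (uniform_cell u) X = emeasure unit_uniform A * emeasure unit_uniform B" .
qed

text \<open>It suffices to compare boxes. A box of offsets is a product over the vertices of
  rectangles in the cells, so its probability factorises first over vertices and then over
  coordinates.\<close>

lemma distr_offset:
  assumes "finite V"
  shows "distr collection_measure (\<Pi>\<^sub>M j\<in>V \<times> UNIV. unit_uniform) (\<lambda>P. \<lambda>j\<in>V \<times> UNIV. offset j P) =
    (\<Pi>\<^sub>M j\<in>V \<times> UNIV. unit_uniform)"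
proof -
  interpret U: prob_space unit_uniform by (rule prob_space_unit_uniform)
  interpret product_prob_space "\<lambda>_ :: vertex \<times> bool. unit_uniform" by standard
  interpret C: product_prob_space uniform_cell UNIV
    by (simp add: product_prob_space_def product_sigma_finite_def product_prob_space_axioms_def
        prob_space_uniform_cell prob_space_imp_sigma_finite)
  have meas: "(\<lambda>P. \<lambda>j\<in>V \<times> UNIV. offset j P) \<in> collection_measure \<rightarrow>\<^sub>M (\<Pi>\<^sub>M j\<in>V \<times> UNIV. unit_uniform)"
    by (intro measurable_restrict) (simp cong: measurable_cong_sets)
  show ?thesis
  proof (rule PiM_eqI)
    fix A :: "vertex \<times> bool \<Rightarrow> real set" assume "\<And>j. j \<in> V \<times> UNIV \<Longrightarrow> A j \<in> sets unit_uniform"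
    then have A: "u \<in> V \<Longrightarrow> A (u, b) \<in> sets borel" for u b by auto
    let ?X = "\<lambda>u. {q \<in> cell u. fst q - of_int (fst u) \<in> A (u, False) \<and> snd q - of_int (snd u) \<in> A (u, True)}"
    have "(\<forall>j\<in>V \<times> UNIV. Q j) \<longleftrightarrow> (\<forall>u\<in>V. Q (u, False) \<and> Q (u, True))" for Q :: "vertex \<times> bool \<Rightarrow> bool"
      by (metis (full_types) SigmaE SigmaI UNIV_I)
    then have split_iff: "(\<lambda>j\<in>V \<times> UNIV. offset j P) \<in> (\<Pi>\<^sub>E j\<in>V \<times> UNIV. A j) \<longleftrightarrow>
      (\<forall>u\<in>V. offset (u, False) P \<in> A (u, False) \<and> offset (u, True) P \<in> A (u, True))" for P
      by (simp only: restrict_PiE_iff)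
    have "(\<lambda>P. \<lambda>j\<in>V \<times> UNIV. offset j P) -` (\<Pi>\<^sub>E j\<in>V \<times> UNIV. A j) \<inter> space collection_measure =
      {P \<in> space collection_measure. \<forall>u\<in>V. P u \<in> ?X u}"
      by (rule set_eqI) (simp add: split_iff offset_def space_collection_measure
          point_collections_def PiE_iff all_bool_eq conj_commute del: split_paired_All cong: conj_cong)
    then have "emeasure (distr collection_measure (\<Pi>\<^sub>M j\<in>V \<times> UNIV. unit_uniform)
        (\<lambda>P. \<lambda>j\<in>V \<times> UNIV. offset j P)) (\<Pi>\<^sub>E j\<in>V \<times> UNIV. A j) =
      emeasure collection_measure {P \<in> space collection_measure. \<forall>u\<in>V. P u \<in> ?X u}"
      using A assms by (subst emeasure_distr[OF meas]) (auto intro!: sets_PiM_I_finite)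
    also have "\<dots> = (\<Prod>u\<in>V. emeasure (uniform_cell u) (?X u))"
      unfolding collection_measure_def
      using assms A by (intro C.emeasure_PiM_Collect) (auto intro!: uniform_cell_Times)
    also have "\<dots> = (\<Prod>u\<in>V. \<Prod>b\<in>UNIV. emeasure unit_uniform (A (u, b)))"
      using A by (intro prod.cong) (simp_all add: uniform_cell_Times UNIV_bool mult.commute)
    also have "\<dots> = (\<Prod>j\<in>V \<times> UNIV. emeasure unit_uniform (A j))"
      by (simp add: prod.cartesian_product case_prod_beta')
    finally show "emeasure (distr collection_measure (\<Pi>\<^sub>M j\<in>V \<times> UNIV. unit_uniform)
        (\<lambda>P. \<lambda>j\<in>V \<times> UNIV. offset j P)) (\<Pi>\<^sub>E j\<in>V \<times> UNIV. A j) =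
        (\<Prod>j\<in>V \<times> UNIV. emeasure unit_uniform (A j))" .
  qed (use assms in auto)
qed

text \<open>The event depends only on the offsets at the finitely many vertices touched by
  \<open>S\<close> and its image, so the bound carries over from the finite product measure.\<close>

lemma prob_gaps_le:
  fixes \<sigma> :: "vertex \<times> bool \<Rightarrow> vertex \<times> bool"
  assumes "inj \<sigma>" "\<And>S. finite S \<Longrightarrow> S \<noteq> {} \<Longrightarrow> \<exists>i\<in>S. \<sigma> i \<notin> S" "0 \<le> s" "s \<le> 1" "finite S"
  shows "measure collection_measure
      {P \<in> space collection_measure. \<forall>i\<in>S. offset i P - offset (\<sigma> i) P \<ge> s} \<le> ((1 - s)\<^sup>2 / 2) ^ card S"
proof -
  interpret prob_space collection_measure by (rule prob_space_collection_measure)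
  define V where "V = fst ` (S \<union> \<sigma> ` S)"
  let ?J = "V \<times> (UNIV :: bool set)"
  let ?U = "\<Pi>\<^sub>M j\<in>?J. unit_uniform"
  let ?E = "{w \<in> space ?U. \<forall>i\<in>S. w i - w (\<sigma> i) \<ge> s}"
  have V: "finite V" "S \<subseteq> ?J" "\<sigma> ` S \<subseteq> ?J"
  proof -
    have "X \<subseteq> fst ` Y \<times> UNIV" if "X \<subseteq> Y" for X Y :: "(vertex \<times> bool) set" using that by force
    then show "S \<subseteq> ?J" "\<sigma> ` S \<subseteq> ?J" unfolding V_def by simp_all
  qed (simp add: V_def assms(5))
  have meas: "(\<lambda>P. \<lambda>j\<in>?J. offset j P) \<in> collection_measure \<rightarrow>\<^sub>M ?U"
    by (intro measurable_restrict) (simp cong: measurable_cong_sets)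
  have comp: "(\<lambda>w. w j) \<in> borel_measurable ?U" if "j \<in> ?J" for j
    by (rule measurable_compose[OF measurable_component_singleton[OF that]]) (simp add: measurable_ident_sets)
  have E: "?E \<in> sets ?U"
  proof (intro sets.sets_Collect_finite_All assms(5))
    fix i assume "i \<in> S"
    then have [measurable]: "(\<lambda>w. w i) \<in> borel_measurable ?U" "(\<lambda>w. w (\<sigma> i)) \<in> borel_measurable ?U"
      using V by (auto intro!: comp)
    show "{w \<in> space ?U. s \<le> w i - w (\<sigma> i)} \<in> sets ?U" by measurable
  qed
  have "(\<lambda>P. \<lambda>j\<in>?J. offset j P) -` ?E \<inter> space collection_measure =
      {P \<in> space collection_measure. \<forall>i\<in>S. offset i P - offset (\<sigma> i) P \<ge> s}"
  proof (rule set_eqI)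
    have inJ: "i \<in> ?J" "\<sigma> i \<in> ?J" if "i \<in> S" for i
      using V(2,3) that by auto
    fix P
    show "P \<in> (\<lambda>P. \<lambda>j\<in>?J. offset j P) -` ?E \<inter> space collection_measure \<longleftrightarrow>
        P \<in> {P \<in> space collection_measure. \<forall>i\<in>S. offset i P - offset (\<sigma> i) P \<ge> s}"
      by (simp add: space_PiM restrict_PiE_iff inJ conj_commute)
  qed
  note preimage = this
  have "emeasure collection_measure
      {P \<in> space collection_measure. \<forall>i\<in>S. offset i P - offset (\<sigma> i) P \<ge> s} =
      emeasure (distr collection_measure ?U (\<lambda>P. \<lambda>j\<in>?J. offset j P)) ?E"
    by (simp only: emeasure_distr[OF meas E] preimage)
  also have "\<dots> = emeasure ?U ?E"
    by (simp only: distr_offset[OF V(1)])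
  also have "\<dots> \<le> ennreal ((1 - s)\<^sup>2 / 2) ^ card S"
    using assms V by (intro emeasure_gaps_le) auto
  finally show ?thesis
    by (simp add: emeasure_eq_measure ennreal_power)
qed

subsection \<open>Self-avoiding paths\<close>

text \<open>A path is stored with its current end point in front and its starting point last.\<close>

definition saw :: "('a \<times> 'a) set \<Rightarrow> 'a \<Rightarrow> 'a list \<Rightarrow> bool" where
  "saw E x xs \<longleftrightarrow> xs \<noteq> [] \<and> last xs = x \<and> distinct xs \<and> successively (\<lambda>a b. (b, a) \<in> E) xs"

lemma saw_Cons:
  "saw E x (a # b # xs) \<longleftrightarrow> (b, a) \<in> E \<and> a \<notin> set (b # xs) \<and> saw E x (b # xs)"
  by (auto simp: saw_def)

lemma saw_suffix: "saw E x (ys @ zs) \<Longrightarrow> zs \<noteq> [] \<Longrightarrow> saw E x zs"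
  by (auto simp: saw_def successively_append_iff)

text \<open>Loop erasure: when a step returns to a vertex already visited, the path is cut back to
  the suffix that starts with this vertex.\<close>

lemma rtrancl_imp_saw:
  assumes "(x, y) \<in> E\<^sup>*"
  shows "\<exists>xs. saw E x xs \<and> hd xs = y"
  using assms
proof (induction rule: rtrancl_induct)
  case base
  then show ?case by (intro exI[of _ "[x]"]) (simp add: saw_def)
next
  case (step y z)
  then obtain xs where xs: "saw E x xs" "hd xs = y" by blast
  show ?case
  proof (cases "z \<in> set xs")
    case True
    then obtain ys zs where "xs = ys @ z # zs" by (meson split_list)
    with xs(1) show ?thesis by (metis list.discI list.sel(1) saw_suffix)
  next
    case False
    with xs step(2) show ?thesis
      by (intro exI[of _ "z # xs"]) (auto simp: saw_def successively_Cons)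
  qed
qed

text \<open>Dropping from the front removes the latest vertices, so the starting point
  survives.\<close>

lemma saw_shorten:
  assumes "saw E x xs" "0 < n" "n \<le> length xs"
  shows "\<exists>ys. saw E x ys \<and> length ys = n"
  using assms saw_suffix[of E x "take (length xs - n) xs" "drop (length xs - n) xs"]
  by (intro exI[of _ "drop (length xs - n) xs"]) auto

lemma saw_hd_in_relpow:
  "saw E x xs \<Longrightarrow> (x, hd xs) \<in> E ^^ (length xs - 1)"
proof (induction xs rule: induct_list012)
  case (3 a b xs)
  then show ?case by (auto simp: saw_Cons intro: relpow_Suc_I)
qed (auto simp: saw_def)

text \<open>Otherwise every self-avoiding path would have fewer than \<open>n\<close> vertices, and
  the reachable set would lie within fewer than \<open>n\<close> steps of \<open>x\<close>, which is
  finite when all degrees are.\<close>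

lemma infinite_reachable_imp_saw:
  assumes inf: "infinite {v. (x, v) \<in> E\<^sup>*}" and fin: "\<And>u. finite {v. (u, v) \<in> E}" and n: "0 < n"
  shows "\<exists>xs. saw E x xs \<and> length xs = n"
proof (rule ccontr)
  assume no: "\<not> ?thesis"
  have fin_pow: "finite {v. (x, v) \<in> E ^^ k}" for k
  proof (induction k)
    case (Suc k)
    have "{v. (x, v) \<in> E ^^ Suc k} = (\<Union>u\<in>{v. (x, v) \<in> E ^^ k}. {v. (u, v) \<in> E})" by auto
    then show ?case using Suc fin by simp
  qed simp
  have "{v. (x, v) \<in> E\<^sup>*} \<subseteq> (\<Union>k<n. {v. (x, v) \<in> E ^^ k})"
  proof
    fix v assume "v \<in> {v. (x, v) \<in> E\<^sup>*}"
    then have "\<exists>xs. saw E x xs \<and> hd xs = v" by (intro rtrancl_imp_saw) simp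
    then obtain xs where xs: "saw E x xs" "hd xs = v" by blast
    then have "length xs < n" using saw_shorten[OF xs(1) n] no by (metis not_le)
    then have "length xs - 1 < n" by simp
    then show "v \<in> (\<Union>k<n. {v. (x, v) \<in> E ^^ k})"
      using saw_hd_in_relpow[OF xs(1)] xs(2) by blast
  qed
  then show False using inf fin_pow finite_subset by blast
qed

text \<open>Each step offers at most \<open>c\<close> choices for the new front vertex; a path of n
  + 1 vertices takes n steps.\<close>

lemma card_saw_le:
  assumes N: "\<And>u. finite {v. (u, v) \<in> E}" "\<And>u. card {v. (u, v) \<in> E} \<le> c"
  shows "finite {xs. saw E x xs \<and> length xs = Suc n} \<and> card {xs. saw E x xs \<and> length xs = Suc n} \<le> c ^ n"
proof (induction n)
  case 0
  have "{xs. saw E x xs \<and> length xs = Suc 0} = {[x]}"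
    by (auto simp: saw_def length_Suc_conv)
  then show ?case by simp
next
  case (Suc n)
  let ?W = "\<lambda>n. {xs. saw E x xs \<and> length xs = Suc n}"
  let ?ext = "\<lambda>xs. (\<lambda>a. a # xs) ` {v. (hd xs, v) \<in> E}"
  have sub: "?W (Suc n) \<subseteq> (\<Union>xs\<in>?W n. ?ext xs)"
  proof
    fix xs assume "xs \<in> ?W (Suc n)"
    then obtain a b ys where xs: "xs = a # b # ys" by (auto simp: length_Suc_conv)
    with \<open>xs \<in> ?W (Suc n)\<close> have "b # ys \<in> ?W n" "xs \<in> ?ext (b # ys)"
      by (auto simp: saw_Cons)
    then show "xs \<in> (\<Union>xs\<in>?W n. ?ext xs)" by (rule UN_I)
  qed
  have fin: "finite (\<Union>xs\<in>?W n. ?ext xs)" using Suc N(1) by auto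
  have "card (?W (Suc n)) \<le> card (\<Union>xs\<in>?W n. ?ext xs)" by (rule card_mono[OF fin sub])
  also have "\<dots> \<le> (\<Sum>xs\<in>?W n. card (?ext xs))" using Suc by (intro card_UN_le) auto
  also have "\<dots> \<le> (\<Sum>xs\<in>?W n. c)"
    by (intro sum_mono order_trans[OF card_image_le N(2)] N(1))
  also have "\<dots> \<le> c ^ n * c" using Suc by simp
  finally show ?case using finite_subset[OF sub fin] by (simp add: mult.commute)
qed

text \<open>A self-avoiding path never returns along the edge it has just used.\<close>

lemma card_saw_le_nonbacktracking:
  assumes N: "\<And>u. finite {v. (u, v) \<in> E}" "\<And>u. card {v. (u, v) \<in> E} \<le> Suc c" and sym: "sym E"
  shows "finite {xs. saw E x xs \<and> length xs = Suc (Suc n)} \<and>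
    card {xs. saw E x xs \<and> length xs = Suc (Suc n)} \<le> Suc c * c ^ n"
proof (induction n)
  case 0
  show ?case using card_saw_le[OF N, where n = 1 and x = x] by simp
next
  case (Suc n)
  let ?W = "\<lambda>n. {xs. saw E x xs \<and> length xs = Suc (Suc n)}"
  let ?ext = "\<lambda>xs. (\<lambda>a. a # xs) ` ({v. (hd xs, v) \<in> E} - {hd (tl xs)})"
  have sub: "?W (Suc n) \<subseteq> (\<Union>xs\<in>?W n. ?ext xs)"
  proof
    fix xs assume "xs \<in> ?W (Suc n)"
    then obtain a b d ys where xs: "xs = a # b # d # ys" by (auto simp: length_Suc_conv)
    with \<open>xs \<in> ?W (Suc n)\<close> have "b # d # ys \<in> ?W n" "xs \<in> ?ext (b # d # ys)"
      by (auto simp: saw_Cons)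
    then show "xs \<in> (\<Union>xs\<in>?W n. ?ext xs)" by (rule UN_I)
  qed
  have fin: "finite (\<Union>xs\<in>?W n. ?ext xs)" using Suc N(1) by auto
  have ext: "card (?ext xs) \<le> c" if xs: "xs \<in> ?W n" for xs
  proof -
    obtain a b ys where "xs = a # b # ys" using xs by (auto simp: length_Suc_conv)
    with xs have "(b, a) \<in> E" by (auto simp: saw_Cons)
    \<comment> \<open>By symmetry the previous vertex is one of the at most c + 1 neighbors, so
      excluding it leaves at most \<open>c\<close>.\<close>
    then have "hd (tl xs) \<in> {v. (hd xs, v) \<in> E}" using sym \<open>xs = _\<close> by (auto dest: symD)
    then have "card ({v. (hd xs, v) \<in> E} - {hd (tl xs)}) \<le> c"
      using N[of "hd xs"] by (simp add: card_Diff_singleton)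
    then show ?thesis by (intro order_trans[OF card_image_le] finite_Diff N(1))
  qed
  have "card (?W (Suc n)) \<le> card (\<Union>xs\<in>?W n. ?ext xs)" by (rule card_mono[OF fin sub])
  also have "\<dots> \<le> (\<Sum>xs\<in>?W n. card (?ext xs))" using Suc by (intro card_UN_le) auto
  also have "\<dots> \<le> (\<Sum>xs\<in>?W n. c)"
    by (intro sum_mono ext)
  also have "\<dots> \<le> Suc c * c ^ n * c" using Suc by simp
  finally show ?case using finite_subset[OF sub fin] by (simp add: mult_ac)
qed

subsection \<open>Lattice edges\<close>

definition nbr :: "(vertex \<times> vertex) set" where
  "nbr = {(u, v). \<bar>fst u - fst v\<bar> + \<bar>snd u - snd v\<bar> = 1}"

text \<open>The pair \<open>(u, b)\<close> encodes the lattice edge from \<open>u\<close> in direction \<open>(1, 0)\<close> if \<open>b\<close> is false and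
  \<open>(0, 1)\<close> if \<open>b\<close> is true.\<close>

definition far_end :: "vertex \<times> bool \<Rightarrow> vertex" where
  "far_end e = (if snd e then (fst (fst e), snd (fst e) + 1) else (fst (fst e) + 1, snd (fst e)))"

text \<open>The collinear edge straight ahead. Read as indices of \<open>offset\<close>,
  \<open>e\<close> and \<open>next_edge e\<close> denote the coordinate along the edge
  \<open>e\<close> at its two ends, which is why edges and offsets share one encoding.\<close>

definition next_edge :: "vertex \<times> bool \<Rightarrow> vertex \<times> bool" where
  "next_edge e = (far_end e, snd e)"

definition edge_between :: "vertex \<Rightarrow> vertex \<Rightarrow> vertex \<times> bool" where
  "edge_between u v =
     (if snd u = snd v then ((min (fst u) (fst v), snd u), False)
      else ((fst u, min (snd u) (snd v)), True))"

lemma inj_next_edge: "inj next_edge"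
  by (rule injI) (auto simp: next_edge_def far_end_def prod_eq_iff split: if_splits)

text \<open>Take an edge of \<open>S\<close> whose base point has maximal coordinate sum;
  \<open>next_edge\<close> raises this sum by 1.\<close>

lemma next_edge_acyclic:
  assumes "finite S" "S \<noteq> {}"
  shows "\<exists>e\<in>S. next_edge e \<notin> S"
proof -
  define w where "w e = fst (fst e) + snd (fst e)" for e :: "vertex \<times> bool"
  obtain e where e: "e \<in> S" "\<And>e'. e' \<in> S \<Longrightarrow> w e' \<le> w e"
    using Max_in[of "w ` S"] Max_ge[of "w ` S"] assms by fastforce
  have "w (next_edge e) = w e + 1"
    by (simp add: w_def next_edge_def far_end_def)
  with e show ?thesis by (metis less_add_one not_less)
qed

lemma edge_between:
  assumes "(u, v) \<in> nbr"
  shows "(u = fst (edge_between u v) \<and> v = far_end (edge_between u v)) \<or>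
         (v = fst (edge_between u v) \<and> u = far_end (edge_between u v))"
  using assms by (cases u; cases v) (auto simp: nbr_def edge_between_def far_end_def)

lemma sym_nbr: "sym nbr"
  by (auto simp: sym_def nbr_def abs_minus_commute)

lemma neighbors:
  "{v. (u, v) \<in> nbr} = set [(fst u + 1, snd u), (fst u - 1, snd u), (fst u, snd u + 1), (fst u, snd u - 1)]"
  by (cases u) (auto simp: nbr_def)

lemma finite_neighbors: "finite {v. (u, v) \<in> nbr}"
  by (simp add: neighbors del: set_simps)

lemma card_neighbors: "card {v. (u, v) \<in> nbr} \<le> 4"
  using card_length[of "[(fst u + 1, snd u), (fst u - 1, snd u), (fst u, snd u + 1), (fst u, snd u - 1)]"]
  by (simp add: neighbors del: set_simps)

fun path_edges :: "vertex list \<Rightarrow> (vertex \<times> bool) set" where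
  "path_edges (u # v # us) = insert (edge_between u v) (path_edges (v # us))"
| "path_edges _ = {}"

lemma path_edges_ends: "saw nbr x us \<Longrightarrow> e \<in> path_edges us \<Longrightarrow> fst e \<in> set us \<and> far_end e \<in> set us"
proof (induction us rule: path_edges.induct)
  case (1 u v us)
  then show ?case using edge_between[of v u] edge_between[of u v] sym_nbr
    by (auto simp: saw_Cons dest: symD)
qed auto

lemma finite_path_edges: "finite (path_edges us)"
  by (induction us rule: path_edges.induct) auto

text \<open>The front vertex is new, while both ends of every edge of the remaining path lie on that
  path, so no edge repeats.\<close>

lemma card_path_edges: "saw nbr x us \<Longrightarrow> card (path_edges us) = length us - 1"
proof (induction us rule: path_edges.induct)
  case (1 u v us)
  then have *: "(u, v) \<in> nbr" "saw nbr x (v # us)" "u \<notin> set (v # us)"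
    using sym_nbr by (auto simp: saw_Cons dest: symD)
  then have "edge_between u v \<notin> path_edges (v # us)"
    using edge_between[OF *(1)] path_edges_ends[OF *(2)] by metis
  then show ?case using 1 * by (simp add: finite_path_edges)
qed auto

subsection \<open>Boundary contours\<close>

definition plaquette :: "int \<Rightarrow> int \<Rightarrow> (vertex \<times> bool) set" where
  "plaquette x y = {((x, y), False), ((x, y + 1), False), ((x, y), True), ((x + 1, y), True)}"

text \<open>Two edges sharing a unit square correspond to dual edges with a common end, so chains of
  this relation are dual paths.\<close>

definition dual_nbr :: "((vertex \<times> bool) \<times> (vertex \<times> bool)) set" where
  "dual_nbr = {(e, f). e \<noteq> f \<and> (\<exists>x y. e \<in> plaquette x y \<and> f \<in> plaquette x y)}"

definition boundary :: "vertex set \<Rightarrow> (vertex \<times> bool) set" where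
  "boundary C = {e. (fst e \<in> C) \<noteq> (far_end e \<in> C)}"

text \<open>An edge lies in two unit squares, and each contributes its three other sides.\<close>

lemma dual_neighbors_subset:
  "\<exists>fs. length fs = 6 \<and> {f. (e, f) \<in> dual_nbr} \<subseteq> set fs"
proof -
  obtain x y b where e: "e = ((x, y), b)" by (metis surj_pair)
  let ?fs = "if b
      then [((x, y), False), ((x, y + 1), False), ((x + 1, y), True),
            ((x - 1, y), False), ((x - 1, y + 1), False), ((x - 1, y), True)]
      else [((x, y + 1), False), ((x, y), True), ((x + 1, y), True),
            ((x, y - 1), False), ((x, y - 1), True), ((x + 1, y - 1), True)]"
  have plaq: "(x', y') = (x, y) \<or> (x', y') = (if b then (x - 1, y) else (x, y - 1))"
    if "e \<in> plaquette x' y'" for x' y'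
    using that by (auto simp: e plaquette_def)
  have "{f. (e, f) \<in> dual_nbr} \<subseteq>
      plaquette x y \<union> (if b then plaquette (x - 1) y else plaquette x (y - 1)) - {e}"
  proof
    fix f assume "f \<in> {f. (e, f) \<in> dual_nbr}"
    then obtain x' y' where "e \<noteq> f" "e \<in> plaquette x' y'" "f \<in> plaquette x' y'"
      by (auto simp: dual_nbr_def)
    then show "f \<in> plaquette x y \<union> (if b then plaquette (x - 1) y else plaquette x (y - 1)) - {e}"
      using plaq[of x' y'] by (cases b) auto
  qed
  also have "\<dots> \<subseteq> set ?fs"
    by (cases b) (auto simp: e plaquette_def)
  finally have "{f. (e, f) \<in> dual_nbr} \<subseteq> set ?fs" .
  moreover have "length ?fs = 6" by simp
  ultimately show ?thesis by blast
qed

lemma finite_dual_neighbors: "finite {f. (e, f) \<in> dual_nbr}"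
  using dual_neighbors_subset[of e] finite_subset by blast

lemma card_dual_neighbors: "card {f. (e, f) \<in> dual_nbr} \<le> 6"
proof -
  obtain fs where fs: "length fs = 6" "{f. (e, f) \<in> dual_nbr} \<subseteq> set fs"
    using dual_neighbors_subset by blast
  then have "card {f. (e, f) \<in> dual_nbr} \<le> card (set fs)" by (intro card_mono) auto
  also have "\<dots> \<le> 6" using card_length[of fs] fs(1) by simp
  finally show ?thesis .
qed

text \<open>Twice the abscissa of the midpoint of the edge.\<close>

definition abscissa2 :: "vertex \<times> bool \<Rightarrow> int" where
  "abscissa2 e = 2 * fst (fst e) + (if snd e then 0 else 1)"

text \<open>Midpoints of two sides of a unit square differ by at most 1 in abscissa, hence by at
  most 2 after doubling.\<close>

lemma abscissa2_saw:
  "saw dual_nbr e es \<Longrightarrow> \<bar>abscissa2 (hd es) - abscissa2 e\<bar> \<le> 2 * (int (length es) - 1)"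
proof (induction es rule: induct_list012)
  case (3 a b es)
  then have "(b, a) \<in> dual_nbr" by (simp add: saw_Cons)
  then have "\<bar>abscissa2 a - abscissa2 b\<bar> \<le> 2"
    by (auto simp: dual_nbr_def plaquette_def abscissa2_def)
  with 3 show ?case by (auto simp: saw_Cons)
qed (auto simp: saw_def)

lemma finite_boundary:
  assumes "finite C" shows "finite (boundary C)"
proof -
  have "finite (C \<times> (UNIV :: bool set))" using assms by simp
  then have "finite (C \<times> UNIV \<union> next_edge -` (C \<times> UNIV))"
    using finite_vimageI[OF _ inj_next_edge] by blast
  moreover have "boundary C \<subseteq> C \<times> UNIV \<union> next_edge -` (C \<times> UNIV)"
    by (auto simp: boundary_def next_edge_def mem_Times_iff)
  ultimately show ?thesis by (rule rev_finite_subset)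
qed

text \<open>The parity of the number of edges of \<open>K\<close> on a horizontal ray changes exactly across the edges
  of \<open>K\<close>, because \<open>K\<close> contains an even number of edges of every plaquette.\<close>

lemma contour_crosses_axis:
  assumes fin: "finite C" and K: "K \<subseteq> boundary C"
    and closed: "\<And>x y e f. e \<in> K \<Longrightarrow> e \<in> plaquette x y \<Longrightarrow> f \<in> plaquette x y \<Longrightarrow> f \<in> boundary C \<Longrightarrow> f \<in> K"
    and conn: "((k, 0), (0, 0)) \<in> (Restr nbr C)\<^sup>*"
    and start: "((k, 0), False) \<in> K" and k: "\<And>x. k < x \<Longrightarrow> (x, 0) \<notin> C"
  shows "\<exists>y. ((0, y), True) \<in> K"
proof -
  have finK: "finite K" using K finite_boundary[OF fin] by (rule finite_subset)
  define N where "N = Max (insert 0 ((\<lambda>e. \<bar>fst (fst e)\<bar> + \<bar>snd (fst e)\<bar> + 1) ` K))"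
  have N0: "0 \<le> N" using finK by (simp add: N_def)
  have N: "\<bar>x\<bar> < N \<and> \<bar>y\<bar> < N" if "((x, y), b) \<in> K" for x y b
  proof -
    have "\<bar>fst (fst ((x, y), b))\<bar> + \<bar>snd (fst ((x, y), b))\<bar> + 1 \<le> N"
      unfolding N_def using that finK by (intro Max_ge insertI2 imageI) auto
    then show ?thesis unfolding fst_conv snd_conv by linarith
  qed
  \<comment> \<open>The parity \<open>f\<close> is the winding number modulo 2 around the vertex (x,
    y), with \<open>K\<close> seen as a union of closed dual curves.\<close>
  define X where "X x y = {i. x \<le> i \<and> ((i, y), False) \<in> K}" for x y
  define f where "f x y \<longleftrightarrow> odd (card (X x y))" for x y
  have finX: "finite (X x y)" for x y
  proof (rule finite_subset)
    show "X x y \<subseteq> (\<lambda>i. ((i, y), False)) -` K" by (auto simp: X_def)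
    show "finite ((\<lambda>i. ((i, y), False)) -` K)" by (intro finite_vimageI finK injI) simp
  qed
  have horizontal: "f x y \<noteq> f (x + 1) y \<longleftrightarrow> ((x, y), False) \<in> K" for x y
  proof -
    have "X x y = (if ((x, y), False) \<in> K then insert x (X (x + 1) y) else X (x + 1) y)"
      by (auto simp: X_def order_le_less)
    moreover have "x \<notin> X (x + 1) y" by (simp add: X_def)
    ultimately show ?thesis using finX by (simp add: f_def)
  qed
  have far_right: "\<not> f x y" if "N \<le> x" for x y
  proof -
    have "i \<notin> X x y" for i using N[of i y False] that by (auto simp: X_def)
    then have "X x y = {}" by blast
    then show ?thesis by (simp add: f_def)
  qed
  have far_up: "\<not> f x N" for x
  proof -
    have "i \<notin> X x N" for i using N[of i N False] by (auto simp: X_def)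
    then have "X x N = {}" by blast
    then show ?thesis by (simp add: f_def)
  qed
  \<comment> \<open>\<open>K\<close> contains none or all of the boundary edges of a plaquette, and
    membership in \<open>C\<close> changes an even number of times around its four corners.\<close>
  have even_plaquette: "((((x, y), False) \<in> K) = (((x, y + 1), False) \<in> K)) =
      ((((x, y), True) \<in> K) = (((x + 1, y), True) \<in> K))" for x y
  proof (cases "K \<inter> plaquette x y = {}")
    case True
    then show ?thesis by (auto simp: plaquette_def)
  next
    case False
    then have "e \<in> K \<longleftrightarrow> e \<in> boundary C" if "e \<in> plaquette x y" for e
      using closed K that by blast
    then show ?thesis
      by (simp add: plaquette_def boundary_def far_end_def) blast
  qed
  \<comment> \<open>Descending induction on \<open>x\<close> from \<open>N\<close>, where
    \<open>f\<close> is false: moving one column to the left changes both sides consistently by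
    \<open>even_plaquette\<close>.\<close>
  have vertical: "f x y \<noteq> f x (y + 1) \<longleftrightarrow> ((x, y), True) \<in> K" for x y
  proof (cases "x \<le> N")
    case True
    then show ?thesis
    proof (induction x rule: int_le_induct)
      case base
      then show ?case using far_right[of N] N[of N y True] N0 by auto
    next
      case (step x)
      then show ?case
        using horizontal[of "x - 1" y] horizontal[of "x - 1" "y + 1"] even_plaquette[of "x - 1" y]
        by auto
    qed
  next
    case False
    then show ?thesis using far_right[of x] N[of x y True] by auto
  qed
  \<comment> \<open>An edge between two vertices of \<open>C\<close> is no boundary edge, so it does
    not change \<open>f\<close>; hence \<open>f\<close> is constant along paths in
    \<open>C\<close>.\<close>
  have const: "f (fst u) (snd u) = f (fst v) (snd v)" if "(u, v) \<in> Restr nbr C" for u v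
  proof -
    let ?e = "edge_between u v"
    from that have uv: "(u, v) \<in> nbr" "u \<in> C" "v \<in> C" by auto
    then have "?e \<notin> K" using K edge_between[OF uv(1)] by (auto simp: boundary_def)
    then have "f (fst (fst ?e)) (snd (fst ?e)) = f (fst (far_end ?e)) (snd (far_end ?e))"
      using horizontal[of "fst (fst ?e)" "snd (fst ?e)"] vertical[of "fst (fst ?e)" "snd (fst ?e)"]
      by (cases ?e) (auto simp: far_end_def)
    then show ?thesis using edge_between[OF uv(1)] by metis
  qed
  \<comment> \<open>No vertex of \<open>C\<close> on the axis lies to the right of (k, 0), so the
    ray from there meets \<open>K\<close> in its first edge only.\<close>
  have "i \<notin> X (k + 1) 0" for i
    using K k[of i] k[of "i + 1"] by (auto simp: X_def boundary_def far_end_def)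
  then have "X (k + 1) 0 = {}" by blast
  then have "f k 0" using horizontal[of k 0] start by (simp add: f_def)
  moreover have "f k 0 = f (fst v) (snd v)" if "((k, 0), v) \<in> (Restr nbr C)\<^sup>*" for v
    using that by (induction rule: rtrancl_induct) (use const in auto)
  ultimately have "f 0 0" using conn by fastforce
  \<comment> \<open>\<open>f\<close> holds at the origin and fails at height \<open>N\<close>, so it
    changes somewhere on the vertical axis.\<close>
  have "\<exists>y. f 0 y \<noteq> f 0 (y + 1)"
  proof (rule ccontr)
    assume "\<not> ?thesis"
    then have const': "f 0 y = f 0 (y + 1)" for y by blast
    have "f 0 (int n)" for n
    proof (induction n)
      case 0
      then show ?case using \<open>f 0 0\<close> by simp
    next
      case (Suc n)
      then show ?case using const'[of "int n"] by (simp only: of_nat_Suc add.commute)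
    qed
    from this[of "nat N"] show False using far_up[of 0] N0 by simp
  qed
  then obtain y where "f 0 y \<noteq> f 0 (y + 1)" by (rule exE)
  then have "((0, y), True) \<in> K" by (simp only: vertical)
  then show ?thesis by (rule exI)
qed

lemma finite_cluster_contour:
  assumes fin: "finite C" and zero: "(0, 0) \<in> C"
    and conn: "\<And>v. v \<in> C \<Longrightarrow> (v, (0, 0)) \<in> (Restr nbr C)\<^sup>*"
  shows "\<exists>k es. saw dual_nbr ((int k, 0), False) es \<and> length es = k + 2 \<and> set es \<subseteq> boundary C"
proof -
  define X where "X = {x. (x, 0) \<in> C}"
  have X: "finite X" "0 \<in> X"
  proof -
    have "X = (\<lambda>x. (x, 0)) -` C" by (auto simp: X_def)
    then show "finite X" using finite_vimageI[OF fin, of "\<lambda>x. (x, 0)"] by (simp add: inj_def)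
  qed (use zero in \<open>simp add: X_def\<close>)
  define k where "k = nat (Max X)"
  have k0: "int k = Max X" using X by (simp add: k_def)
  have "int k \<in> X" using X Max_in[of X] k0 by (metis empty_iff)
  then have kC: "(int k, 0) \<in> C" by (simp add: X_def)
  have k: "(x, 0) \<notin> C" if "int k < x" for x
    using Max_ge[OF X(1), of x] that k0 by (auto simp: X_def)
  let ?e0 = "((int k, 0), False)"
  have e0: "?e0 \<in> boundary C"
    using kC k[of "int k + 1"] by (simp add: boundary_def far_end_def)
  let ?A = "Restr dual_nbr (boundary C)"
  \<comment> \<open>The contour is the dual component, within the boundary of \<open>C\<close>, of
    the edge that leaves \<open>C\<close> at its rightmost vertex on the axis.\<close>
  define K where "K = {e. (?e0, e) \<in> ?A\<^sup>*}"
  have KB: "K \<subseteq> boundary C"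
  proof
    fix e assume "e \<in> K"
    then have "(?e0, e) \<in> ?A\<^sup>*" by (simp add: K_def)
    then show "e \<in> boundary C" by (cases rule: rtranclE) (use e0 in auto)
  qed
  have "\<exists>y. ((0, y), True) \<in> K"
  proof (rule contour_crosses_axis[OF fin KB])
    fix x y e f
    assume *: "e \<in> K" "e \<in> plaquette x y" "f \<in> plaquette x y" "f \<in> boundary C"
    show "f \<in> K"
    proof (cases "e = f")
      case False
      with * KB have "(e, f) \<in> ?A" by (auto simp: dual_nbr_def)
      with *(1) show ?thesis by (simp add: K_def rtrancl_into_rtrancl)
    qed (use * in simp)
  next
    show "((int k, 0), (0, 0)) \<in> (Restr nbr C)\<^sup>*" by (rule conn[OF kC])
    show "?e0 \<in> K" by (simp add: K_def)
  qed (fact k)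
  then obtain y where "(?e0, ((0, y), True)) \<in> ?A\<^sup>*"
    unfolding K_def mem_Collect_eq by (rule exE)
  from rtrancl_imp_saw[OF this] obtain es where es: "saw ?A ?e0 es" "hd es = ((0, y), True)"
    by (elim exE conjE)
  have sawD: "saw dual_nbr ?e0 es \<and> set es \<subseteq> boundary C" if "saw ?A ?e0 es" for es
    using that
  proof (induction es rule: induct_list012)
    case (3 a b es)
    then show ?case by (auto simp: saw_Cons)
  qed (use e0 in \<open>auto simp: saw_def\<close>)
  \<comment> \<open>The doubled abscissa goes from 2k + 1 to 0 in steps of at most 2; by integrality
    this takes at least k + 1 steps, that is, k + 2 edges.\<close>
  have "2 * int k + 1 \<le> 2 * (int (length es) - 1)"
    using abscissa2_saw[of ?e0 es] sawD[OF es(1)] es(2) by (simp add: abscissa2_def)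
  then have "k + 2 \<le> length es" by presburger
  with saw_shorten[OF es(1), of "k + 2"]
  obtain es' where es': "saw ?A ?e0 es'" "length es' = k + 2" by (metis zero_less_Suc add_2_eq_Suc')
  show ?thesis
    by (intro exI[of _ k] exI[of _ es']) (use sawD[OF es'(1)] es'(2) in blast)
qed

subsection \<open>Open and closed edges as gaps\<close>

lemma lp_norm_mono:
  assumes p: "1 \<le> p" and "\<bar>a\<bar> \<le> c" "\<bar>b\<bar> \<le> d"
  shows "lp_norm p (a, b) \<le> lp_norm p (c, d)"
proof (cases p)
  case (real r)
  then have "1 \<le> r" using p by simp
  with real assms show ?thesis
    by (auto simp: lp_norm_def intro!: powr_mono2 add_mono add_nonneg_nonneg)
qed (use assms in \<open>auto simp: lp_norm_def\<close>)

lemma lp_norm_swap: "lp_norm p (a, b) = lp_norm p (b, a)"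
  by (simp add: lp_norm_def max.commute add.commute)

lemma abs_fst_le_lp_norm:
  assumes p: "1 \<le> p" shows "\<bar>fst Q\<bar> \<le> lp_norm p Q"
proof -
  have "\<bar>fst Q\<bar> = lp_norm p (\<bar>fst Q\<bar>, 0)"
  proof (cases p)
    case (real r)
    then have "1 \<le> r" using p by simp
    with real show ?thesis by (simp add: lp_norm_def powr_powr)
  qed (use p in \<open>auto simp: lp_norm_def\<close>)
  also have "\<dots> \<le> lp_norm p (\<bar>fst Q\<bar>, \<bar>snd Q\<bar>)"
    by (rule lp_norm_mono[OF p]) simp_all
  also have "\<dots> = lp_norm p Q"
    by (simp add: lp_norm_def)
  finally show ?thesis .
qed

lemma abs_snd_le_lp_norm: "1 \<le> p \<Longrightarrow> \<bar>snd Q\<bar> \<le> lp_norm p Q"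
  using abs_fst_le_lp_norm[of p "(snd Q, fst Q)"] lp_norm_swap[of p "snd Q" "fst Q"] by simp

lemma nn_edges_altdef: "nn_edges p R P = cn_edges p R P \<inter> nbr"
proof -
  have "lp_norm 1 (of_int a, of_int b) = 1 \<longleftrightarrow> \<bar>a\<bar> + \<bar>b\<bar> = 1" for a b :: int
  proof -
    have "lp_norm 1 (of_int a, of_int b) = of_int (\<bar>a\<bar> + \<bar>b\<bar>)"
      by (simp add: lp_norm_def)
    then show ?thesis by (metis of_int_1 of_int_eq_iff)
  qed
  then show ?thesis by (simp add: nn_edges_def nbr_def flip: of_int_diff)
qed

lemma sym_nn_edges: "sym (nn_edges p R P)"
  using sym_edges[of NN p R P] by simp

lemma offset_bounds:
  assumes "P \<in> point_collections"
  shows "0 \<le> offset e P" "offset e P \<le> 1"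
proof -
  have "P (fst e) \<in> cell (fst e)" using assms by (auto simp: point_collections_def)
  then show "0 \<le> offset e P" "offset e P \<le> 1" by (auto simp: cell_def offset_def mem_Times_iff)
qed

lemma edge_diff:
  "P (far_end (u, False)) - P u =
     (1 + offset (next_edge (u, False)) P - offset (u, False) P,
      offset (far_end (u, False), True) P - offset (u, True) P)"
  "P (far_end (u, True)) - P u =
     (offset (far_end (u, True), False) P - offset (u, False) P,
      1 + offset (next_edge (u, True)) P - offset (u, True) P)"
  by (simp_all add: prod_eq_iff far_end_def next_edge_def offset_def)

text \<open>Every p-norm dominates the coordinate along the edge, in which the two points differ by
  1 minus the drop of the offset.\<close>

lemma gap_of_open_edge:
  assumes p: "1 \<le> p" and uv: "(u, v) \<in> nn_edges p R P"
  shows "offset (edge_between u v) P - offset (next_edge (edge_between u v)) P \<ge> 1 - R"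
proof -
  define e where "e = edge_between u v"
  have "(u, v) \<in> nbr" using uv by (simp add: nn_edges_altdef)
  then have "(far_end e, fst e) \<in> nn_edges p R P"
    using edge_between[of u v] uv sym_nn_edges[of p R P] unfolding e_def by (metis symD)
  then have le: "lp_norm p (P (far_end e) - P (fst e)) \<le> R"
    by (simp add: nn_edges_def cn_edges_def)
  have "\<bar>1 + offset (next_edge e) P - offset e P\<bar> \<le> lp_norm p (P (far_end e) - P (fst e))"
  proof (cases e)
    case (Pair w b)
    show ?thesis
      using abs_fst_le_lp_norm[OF p, of "P (far_end e) - P (fst e)"]
        abs_snd_le_lp_norm[OF p, of "P (far_end e) - P (fst e)"]
      by (cases b) (simp_all add: Pair edge_diff)
  qed
  with le show ?thesis unfolding e_def by linarith
qed

text \<open>If the rise were below 1/2, the points would differ by at most 3/2 along the edge and by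
  at most 1 across it, which makes the edge open.\<close>

lemma gap_of_closed_edge:
  assumes p: "1 \<le> p" and R: "lp_norm p (1, 3 / 2) \<le> R" and P: "P \<in> point_collections"
    and closed: "(far_end e, fst e) \<notin> nn_edges p R P"
  shows "offset (next_edge e) P - offset e P \<ge> 1 / 2"
proof (rule ccontr)
  assume "\<not> ?thesis"
  then have less: "offset (next_edge e) P - offset e P \<le> 1 / 2" by simp
  obtain w b where e: "e = (w, b)" by (metis surj_pair)
  note bounds = offset_bounds[OF P]
  have "lp_norm p (P (far_end e) - P (fst e)) \<le> lp_norm p (1, 3 / 2)"
  proof (cases b)
    case True
    have "\<bar>offset (far_end (w, True), False) P - offset (w, False) P\<bar> \<le> 1"
      using bounds[of "(far_end (w, True), False)"] bounds[of "(w, False)"] by linarith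
    moreover have "\<bar>1 + offset (next_edge e) P - offset e P\<bar> \<le> 3 / 2"
      using bounds[of e] bounds[of "next_edge e"] less by linarith
    ultimately show ?thesis
      by (simp only: e True fst_conv edge_diff lp_norm_mono[OF p])
  next
    case False
    have "\<bar>offset (far_end (w, False), True) P - offset (w, True) P\<bar> \<le> 1"
      using bounds[of "(far_end (w, False), True)"] bounds[of "(w, True)"] by linarith
    moreover have "\<bar>1 + offset (next_edge e) P - offset e P\<bar> \<le> 3 / 2"
      using bounds[of e] bounds[of "next_edge e"] less by linarith
    moreover have "b = False" using False by simp
    ultimately show ?thesis
      by (simp only: e fst_conv edge_diff lp_norm_mono[OF p] lp_norm_swap[of p 1 "3 / 2"])
  qed
  moreover have "far_end e \<noteq> fst e" "(far_end e, fst e) \<in> nbr"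
    by (auto simp: far_end_def nbr_def prod_eq_iff)
  ultimately show False using closed R by (simp add: nn_edges_altdef cn_edges_def)
qed

subsection \<open>Absence of percolation at small radii\<close>

lemma finite_cn_neighbors:
  assumes p: "1 \<le> p" and P: "P \<in> point_collections"
  shows "finite {v. (u, v) \<in> cn_edges p R P}"
proof -
  \<comment> \<open>The additional 1 on the left accounts for the width of a cell: a point may
    exceed the lower left corner of its cell by up to 1.\<close>
  let ?I = "\<lambda>c. {\<lfloor>c - R\<rfloor> - 1..\<lceil>c + R\<rceil>}"
  have "{v. (u, v) \<in> cn_edges p R P} \<subseteq> ?I (fst (P u)) \<times> ?I (snd (P u))"
  proof
    fix v assume "v \<in> {v. (u, v) \<in> cn_edges p R P}"
    then have "lp_norm p (P u - P v) \<le> R"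
      by (simp add: cn_edges_def)
    then have "\<bar>fst (P u) - fst (P v)\<bar> \<le> R" "\<bar>snd (P u) - snd (P v)\<bar> \<le> R"
      using abs_fst_le_lp_norm[OF p, of "P u - P v"] abs_snd_le_lp_norm[OF p, of "P u - P v"] by simp_all
    moreover have "P v \<in> cell v" using P by (auto simp: point_collections_def)
    ultimately show "v \<in> ?I (fst (P u)) \<times> ?I (snd (P u))"
      by (auto simp: cell_def mem_Times_iff) linarith+
  qed
  then show ?thesis by (rule finite_subset) simp
qed

lemma saw_cn_diameter:
  fixes P :: "vertex \<Rightarrow> real \<times> real" and R :: real
  assumes p: "1 \<le> p" and "saw (cn_edges p R P) u us" "v \<in> set us" and R: "0 \<le> R"
  shows "\<bar>fst (P v) - fst (P u)\<bar> \<le> real (length us - 1) * R \<and>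
         \<bar>snd (P v) - snd (P u)\<bar> \<le> real (length us - 1) * R"
  using assms(2,3)
proof (induction us arbitrary: v rule: induct_list012)
  case (3 a b us)
  let ?n = "length us"
  have saw: "saw (cn_edges p R P) u (b # us)" using 3 by (simp add: saw_Cons)
  have IH: "\<bar>fst (P w) - fst (P u)\<bar> \<le> ?n * R" "\<bar>snd (P w) - snd (P u)\<bar> \<le> ?n * R" if "w \<in> set (b # us)" for w
    using 3(2)[OF saw that] by simp_all
  have len: "real (length (a # b # us) - 1) * R = ?n * R + R" by (simp add: algebra_simps)
  show ?case
  proof (cases "v = a")
    case True
    have "lp_norm p (P b - P a) \<le> R"
      using 3 by (simp add: saw_Cons cn_edges_def)
    then have "\<bar>fst (P b) - fst (P a)\<bar> \<le> R" "\<bar>snd (P b) - snd (P a)\<bar> \<le> R"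
      using abs_fst_le_lp_norm[OF p, of "P b - P a"] abs_snd_le_lp_norm[OF p, of "P b - P a"] by simp_all
    moreover have "b \<in> set (b # us)" by simp
    ultimately show ?thesis unfolding len True using IH[of b] by linarith
  next
    case False
    then have "v \<in> set (b # us)" using 3 by simp
    from IH[OF this] show ?thesis unfolding len using R by linarith
  qed
qed (auto simp: saw_def)

text \<open>Along 25 steps of length at most 1/25 every coordinate changes by at most 1 and so stays
  between -1 and 2. Hence the corners of the visited cells lie between -2 and 2, which leaves 25
  cells for 26 vertices.\<close>

lemma percolation_prob_CN_small:
  assumes p: "1 \<le> p"
  shows "percolation_prob CN p (1 / 25) = 0"
proof -
  have "finite (origin_component (cn_edges p (1 / 25) P))" if P: "P \<in> point_collections" for P
  proof (rule ccontr)
    assume "infinite (origin_component (cn_edges p (1 / 25) P))"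
    then obtain us where us: "saw (cn_edges p (1 / 25) P) (0, 0) us" "length us = 26"
      using infinite_reachable_imp_saw[OF _ finite_cn_neighbors[OF p P], where n = 26 and x = "(0, 0)"]
      by (auto simp: origin_component_def)
    have cell: "P v \<in> cell v" for v using P by (auto simp: point_collections_def)
    have "set us \<subseteq> {-2..2} \<times> {-2..2}"
    proof
      fix v assume "v \<in> set us"
      from saw_cn_diameter[OF p us(1) this]
      have "\<bar>fst (P v) - fst (P (0, 0))\<bar> \<le> 1" "\<bar>snd (P v) - snd (P (0, 0))\<bar> \<le> 1"
        by (simp_all add: us(2))
      moreover have "0 \<le> fst (P (0, 0))" "fst (P (0, 0)) \<le> 1" "0 \<le> snd (P (0, 0))" "snd (P (0, 0)) \<le> 1"
        "of_int (fst v) \<le> fst (P v)" "fst (P v) \<le> of_int (fst v) + 1"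
        "of_int (snd v) \<le> snd (P v)" "snd (P v) \<le> of_int (snd v) + 1"
        using cell[of "(0, 0)"] cell[of v] by (auto simp: cell_def mem_Times_iff)
      ultimately have "of_int (fst v) \<le> (2::real)" "of_int (snd v) \<le> (2::real)"
        "(-2::real) \<le> of_int (fst v)" "(-2::real) \<le> of_int (snd v)"
        by linarith+
      then show "v \<in> {-2..2} \<times> {-2..2}" by (auto simp: mem_Times_iff)
    qed
    then have "card (set us) \<le> card ({-2..2::int} \<times> {-2..2::int})" by (intro card_mono) auto
    also have "\<dots> = 25" by (simp add: card_cartesian_product)
    finally show False using us distinct_card[of us] by (simp add: saw_def)
  qed
  then have "{P \<in> space collection_measure. infinite (origin_component (edges CN p (1 / 25) P))} = {}"
    by (auto simp: space_collection_measure)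
  then show ?thesis by (simp only: percolation_prob_def measure_empty)
qed

lemma gap_event_measurable:
  fixes f g :: "'i \<Rightarrow> vertex \<times> bool"
  assumes "finite S"
  shows "{P \<in> space collection_measure. \<forall>i\<in>S. offset (f i) P - offset (g i) P \<ge> s} \<in> sets collection_measure"
  using assms by measurable

lemma percolation_prob_NN_small:
  assumes p: "1 \<le> p"
  shows "percolation_prob NN p (4 / 5) = 0"
proof -
  interpret prob_space collection_measure by (rule prob_space_collection_measure)
  \<comment> \<open>The gap is 1 - 4/5 = 1/5, and (1 - 1/5)^2 / 2 = 8/25.\<close>
  let ?q = "8 / 25 :: real"
  define W where "W n = {us. saw nbr (0, 0) us \<and> length us = Suc (Suc n)}" for n
  define B where "B us = {P \<in> space collection_measure. \<forall>e\<in>path_edges us.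
      offset e P - offset (next_edge e) P \<ge> 1 / 5}" for us
  have W: "finite (W n)" "card (W n) \<le> 4 * 3 ^ n" for n
    using card_saw_le_nonbacktracking[OF finite_neighbors, of 3 "(0, 0)" n] card_neighbors sym_nbr
    by (simp_all add: W_def)
  have B_sets: "B us \<in> sets collection_measure" for us
    unfolding B_def by (rule gap_event_measurable[OF finite_path_edges])
  have B: "prob (B us) \<le> ?q ^ Suc n" if "us \<in> W n" for us n
    using prob_gaps_le[OF inj_next_edge next_edge_acyclic, of "1 / 5" "path_edges us"] that
      card_path_edges[of "(0, 0)" us]
    by (simp add: B_def W_def finite_path_edges power2_eq_square del: power_Suc)
  have sub: "{P \<in> space collection_measure. infinite (origin_component (edges NN p (4 / 5) P))}
      \<subseteq> (\<Union>us\<in>W n. B us)" for n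
  proof
    fix P assume "P \<in> {P \<in> space collection_measure. infinite (origin_component (edges NN p (4 / 5) P))}"
    then have P: "P \<in> space collection_measure" and inf: "infinite {v. ((0, 0), v) \<in> (nn_edges p (4 / 5) P)\<^sup>*}"
      by (simp_all add: origin_component_def)
    have "finite {v. (u, v) \<in> nn_edges p (4 / 5) P}" for u
      by (rule finite_subset[OF _ finite_neighbors[of u]]) (auto simp: nn_edges_altdef)
    from infinite_reachable_imp_saw[OF inf this, of "Suc (Suc n)"]
    obtain us where us: "saw (nn_edges p (4 / 5) P) (0, 0) us" "length us = Suc (Suc n)" by auto
    have "saw nbr (0, 0) us \<and> (\<forall>e\<in>path_edges us. offset e P - offset (next_edge e) P \<ge> 1 / 5)"
      using us(1)
    proof (induction us rule: path_edges.induct)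
      case (1 u v us)
      then have "(u, v) \<in> nn_edges p (4 / 5) P"
        using sym_nn_edges[of p "4 / 5" P] by (auto simp: saw_Cons dest: symD)
      from gap_of_open_edge[OF p this] 1 show ?case by (auto simp: saw_Cons nn_edges_altdef)
    qed (auto simp: saw_def)
    then show "P \<in> (\<Union>us\<in>W n. B us)" using P us(2) by (auto simp: W_def B_def)
  qed
  \<comment> \<open>Union bound over the paths: 4 * 8/25 = 32/25 and 3 * 8/25 = 24/25. The bound
    holds for every \<open>n\<close> and tends to 0.\<close>
  have bound: "percolation_prob NN p (4 / 5) \<le> 32 / 25 * (24 / 25) ^ n" for n
  proof -
    have "percolation_prob NN p (4 / 5) \<le> prob (\<Union>us\<in>W n. B us)"
      unfolding percolation_prob_def using W B_sets by (intro finite_measure_mono sub) auto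
    also have "\<dots> \<le> (\<Sum>us\<in>W n. prob (B us))"
      using W B_sets by (intro finite_measure_subadditive_finite) auto
    also have "\<dots> \<le> (\<Sum>us\<in>W n. ?q ^ Suc n)" by (intro sum_mono B)
    also have "\<dots> = real (card (W n)) * ?q ^ Suc n" by simp
    also have "\<dots> \<le> real (4 * 3 ^ n) * ?q ^ Suc n"
      by (intro mult_right_mono) (use W(2)[of n] of_nat_mono in \<open>blast, simp\<close>)
    also have "\<dots> = 32 / 25 * (24 / 25) ^ n"
      by (simp add: power_divide) (simp flip: power_mult_distrib)
    finally show ?thesis .
  qed
  have "(\<lambda>n. 32 / 25 * (24 / 25) ^ n :: real) \<longlonglongrightarrow> 32 / 25 * 0"
    by (intro tendsto_mult tendsto_const LIMSEQ_power_zero) simp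
  then have "percolation_prob NN p (4 / 5) \<le> 0"
    using LIMSEQ_le_const bound by (metis mult_zero_right)
  then show ?thesis by (simp add: percolation_prob_def measure_le_0_iff)
qed

subsection \<open>Percolation at large radii\<close>

definition prev_edge :: "vertex \<times> bool \<Rightarrow> vertex \<times> bool" where
  "prev_edge e = (if snd e then (fst (fst e), snd (fst e) - 1) else (fst (fst e) - 1, snd (fst e)), snd e)"

lemma prev_next_edge [simp]: "prev_edge (next_edge e) = e"
  by (simp add: prev_edge_def next_edge_def far_end_def prod_eq_iff)

lemma next_prev_edge [simp]: "next_edge (prev_edge e) = e"
  by (simp add: prev_edge_def next_edge_def far_end_def prod_eq_iff)

lemma prev_edge_acyclic:
  assumes "finite S" "S \<noteq> {}"
  shows "\<exists>e\<in>S. prev_edge e \<notin> S"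
proof -
  define w where "w e = fst (fst e) + snd (fst e)" for e :: "vertex \<times> bool"
  obtain e where e: "e \<in> S" "\<And>e'. e' \<in> S \<Longrightarrow> w e \<le> w e'"
    using Min_in[of "w ` S"] Min_le[of "w ` S"] assms by fastforce
  have "w (prev_edge e) = w e - 1"
    by (simp add: w_def prev_edge_def)
  with e(2)[of "prev_edge e"] e(1) show ?thesis by (intro bexI[of _ e]) auto
qed

text \<open>Closed edges give gaps in the opposite direction, so the gap bound is applied to
  \<open>prev_edge\<close> on the image of \<open>S\<close> under \<open>next_edge\<close>; (1 -
  1/2)^2 / 2 = 1/8.\<close>

lemma prob_closed_edges_le:
  assumes "finite S"
  shows "measure collection_measure
      {P \<in> space collection_measure. \<forall>e\<in>S. offset (next_edge e) P - offset e P \<ge> 1 / 2} \<le> (1 / 8) ^ card S"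
proof -
  have "inj prev_edge" by (metis injI next_prev_edge)
  moreover have "card (next_edge ` S) = card S"
    by (intro card_image inj_on_subset[OF inj_next_edge]) simp
  ultimately show ?thesis
    using prob_gaps_le[of prev_edge "1 / 2" "next_edge ` S"] prev_edge_acyclic assms
    by (simp add: power2_eq_square)
qed

text \<open>The component is connected through lattice edges between its own vertices, so it has a
  contour. An open edge with one end in the component would put the other end there too, so boundary
  edges are closed.\<close>

lemma finite_component_contour:
  assumes "finite (origin_component (nn_edges p R P))"
  shows "\<exists>k es. saw dual_nbr ((int k, 0), False) es \<and> length es = k + 2 \<and>
    (\<forall>e\<in>set es. (far_end e, fst e) \<notin> nn_edges p R P)"
proof -
  let ?E = "nn_edges p R P" and ?C = "origin_component (nn_edges p R P)"
  have "(v, (0, 0)) \<in> (Restr nbr ?C)\<^sup>*" if "v \<in> ?C" for v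
  proof -
    have "((0, 0), v) \<in> ?E\<^sup>*" using that by (simp add: origin_component_def)
    then have "((0, 0), v) \<in> (Restr nbr ?C)\<^sup>*"
    proof (induction rule: rtrancl_induct)
      case (step u v)
      then have "(u, v) \<in> Restr nbr ?C"
        by (auto simp: origin_component_def nn_edges_altdef intro: rtrancl_into_rtrancl)
      with step.IH show ?case by (rule rtrancl_into_rtrancl)
    qed simp
    moreover have "sym (Restr nbr ?C)" using sym_nbr by (auto simp: sym_def)
    ultimately show ?thesis by (metis sym_rtrancl symD)
  qed
  then obtain k es where es: "saw dual_nbr ((int k, 0), False) es" "length es = k + 2" "set es \<subseteq> boundary ?C"
    using finite_cluster_contour[OF assms] by (auto simp: origin_component_def)
  have "(far_end e, fst e) \<notin> ?E" if "e \<in> boundary ?C" for e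
  proof
    assume *: "(far_end e, fst e) \<in> ?E"
    then have "(fst e, far_end e) \<in> ?E" using sym_nn_edges symD by metis
    with * that show False
      by (auto simp: boundary_def origin_component_def intro: rtrancl_into_rtrancl)
  qed
  with es show ?thesis by blast
qed

lemma percolation_prob_NN_large:
  assumes p: "1 \<le> p" and R: "lp_norm p (1, 3 / 2) \<le> R"
  shows "0 < percolation_prob NN p R"
proof -
  interpret prob_space collection_measure by (rule prob_space_collection_measure)
  define W where "W k = {es. saw dual_nbr ((int k, 0), False) es \<and> length es = k + 2}" for k
  define B where "B es = {P \<in> space collection_measure. \<forall>e\<in>set es.
      offset (next_edge e) P - offset e P \<ge> 1 / 2}" for es
  let ?F = "{P \<in> space collection_measure. \<not> infinite (origin_component (edges NN p R P))}"
  have W: "finite (W k)" "card (W k) \<le> 6 ^ (k + 1)" for k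
    using card_saw_le[OF finite_dual_neighbors card_dual_neighbors, of "((int k, 0), False)" "k + 1"]
    by (simp_all add: W_def)
  have B_sets: "B es \<in> sets collection_measure" for es
    unfolding B_def by (rule gap_event_measurable) simp
  have B: "prob (B es) \<le> (1 / 8) ^ (k + 2)" if "es \<in> W k" for es k
    using prob_closed_edges_le[of "set es"] that distinct_card[of es]
    by (simp add: B_def W_def saw_def del: power_Suc)
  \<comment> \<open>There are at most 6^(k + 1) contours, each of probability at most (1/8)^(k + 2),
    and 6/64 = 3/32.\<close>
  have BW: "prob (\<Union>es\<in>W k. B es) \<le> 3 / 32 * (3 / 4) ^ k" for k
  proof -
    have "prob (\<Union>es\<in>W k. B es) \<le> (\<Sum>es\<in>W k. prob (B es))"
      using W B_sets by (intro finite_measure_subadditive_finite) auto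
    also have "\<dots> \<le> (\<Sum>es\<in>W k. (1 / 8) ^ (k + 2))" by (intro sum_mono B)
    also have "\<dots> = real (card (W k)) * (1 / 8) ^ (k + 2)" by simp
    also have "\<dots> \<le> real (6 ^ (k + 1)) * (1 / 8) ^ (k + 2)"
      by (intro mult_right_mono) (use W(2)[of k] of_nat_mono in \<open>blast, simp\<close>)
    also have "\<dots> = 3 / 32 * (6 * (1 / 8)) ^ k"
      unfolding power_mult_distrib by (simp add: power_add)
    finally show ?thesis by simp
  qed
  have sums: "(\<lambda>k. 3 / 32 * (3 / 4) ^ k :: real) sums (3 / 8)"
    using sums_mult[OF geometric_sums[of "3 / 4 :: real"], of "3 / 32"] by simp
  have sub: "?F \<subseteq> (\<Union>k. \<Union>es\<in>W k. B es)"
  proof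
    fix P assume "P \<in> ?F"
    then have P: "P \<in> space collection_measure" and fin: "finite (origin_component (nn_edges p R P))"
      by simp_all
    from finite_component_contour[OF fin] obtain k es where
      es: "es \<in> W k" "\<forall>e\<in>set es. (far_end e, fst e) \<notin> nn_edges p R P" by (auto simp: W_def)
    then have "P \<in> B es"
      using gap_of_closed_edge[OF p R] P by (simp add: B_def space_collection_measure)
    with es(1) show "P \<in> (\<Union>k. \<Union>es\<in>W k. B es)" by blast
  qed
  have UN_sets: "(\<Union>es\<in>W k. B es) \<in> sets collection_measure" for k
    using W B_sets by (intro sets.finite_UN) auto
  have "prob ?F \<le> prob (\<Union>k. \<Union>es\<in>W k. B es)"
    using UN_sets by (intro finite_measure_mono sub) auto
  also have "\<dots> \<le> (\<Sum>k. prob (\<Union>es\<in>W k. B es))"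
    using UN_sets BW
    by (intro finite_measure_subadditive_countably summable_comparison_test'[OF sums_summable[OF sums]]) auto
  also have "\<dots> \<le> (\<Sum>k. 3 / 32 * (3 / 4) ^ k)"
    using BW by (intro suminf_le summable_comparison_test'[OF sums_summable[OF sums]] sums_summable[OF sums]) auto
  also have "\<dots> = 3 / 8" using sums by (rule sums_unique[symmetric])
  finally have "prob ?F \<le> 3 / 8" .
  moreover have "prob ?F = 1 - percolation_prob NN p R"
    unfolding percolation_prob_def by (rule prob_neg) (rule percolation_event_measurable)
  ultimately show ?thesis by simp
qed

section \<open>Comparison of the radii\<close>

lemma percolation_prob_NN_le_CN: "percolation_prob NN p R \<le> percolation_prob CN p R"
proof -
  interpret prob_space collection_measure by (rule prob_space_collection_measure)
  have "origin_component (nn_edges p R P) \<subseteq> origin_component (cn_edges p R P)" for P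
  proof -
    have "(nn_edges p R P)\<^sup>* \<subseteq> (cn_edges p R P)\<^sup>*"
      by (rule rtrancl_mono) (simp add: nn_edges_def)
    then show ?thesis by (auto simp: origin_component_def)
  qed
  then show ?thesis
    unfolding percolation_prob_def
    by (intro finite_measure_mono percolation_event_measurable) (auto dest: finite_subset)
qed

text \<open>One argument serves both models: a radius of percolation probability 0 in either model
  has nearest neighbor probability 0, so it lies below the norm of (1, 3/2).\<close>

lemma critical_radius_le:
  assumes p: "1 \<le> p"
  shows "critical_radius m p \<le> ereal (lp_norm p (1, 3 / 2))"
  unfolding critical_radius_def
proof (rule SUP_least)
  fix R assume "R \<in> {R. 0 < R \<and> percolation_prob m p R = 0}"
  then have "percolation_prob NN p R \<le> 0"
    using percolation_prob_NN_le_CN[of p R] by (cases m) auto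
  then have "\<not> lp_norm p (1, 3 / 2) \<le> R"
    using percolation_prob_NN_large[OF p, of R] by (meson not_le)
  then show "ereal R \<le> ereal (lp_norm p (1, 3 / 2))" by simp
qed

lemma min_radius_CN_le_critical_radius:
  assumes p: "1 \<le> p"
  shows "min_radius CN p \<le> critical_radius CN p"
proof (rule dense_le)
  have crit: "ereal R \<le> critical_radius CN p" if "0 < R" "percolation_prob CN p R = 0" for R
    unfolding critical_radius_def using that by (intro SUP_upper) simp
  fix r assume r: "r < min_radius CN p"
  show "r \<le> critical_radius CN p"
  proof (cases "r \<le> ereal (1 / 25)")
    \<comment> \<open>This case contains the values \<open>r\<close> \<le> 0, which are not radii in
      the supremum; the explicit radius 1/25 bounds them.\<close>
    case True
    then show ?thesis
      using crit[of "1 / 25"] percolation_prob_CN_small[OF p] by (simp add: order_trans)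
  next
    case False
    then obtain R where R: "r = ereal R" "0 < R" using r by (cases r) auto
    have "R \<notin> {R. R > 0 \<and> (\<exists>P\<in>point_collections. infinite (origin_component (edges CN p R P)))}"
    proof
      assume "R \<in> {R. R > 0 \<and> (\<exists>P\<in>point_collections. infinite (origin_component (edges CN p R P)))}"
      then have "min_radius CN p \<le> ereal R" unfolding min_radius_def by (rule INF_lower)
      with r R(1) show False by simp
    qed
    then have "{P \<in> space collection_measure. infinite (origin_component (edges CN p R P))} = {}"
      using R(2) by (auto simp: space_collection_measure)
    then have "percolation_prob CN p R = 0" by (simp only: percolation_prob_def measure_empty)
    with crit R show ?thesis by simp
  qed
qed

theorem theorem6:
  fixes p :: ereal
  assumes "1 \<le> p"
  shows "(min_radius CN p \<le> critical_radius CN p \<and>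
          critical_radius CN p \<le> ereal (lp_norm p (1, 3 / 2))) \<and>
         (ereal (sqrt (2 - sqrt 2)) \<le> critical_radius NN p \<and>
          critical_radius NN p \<le> ereal (lp_norm p (1, 3 / 2)))"
proof -
  have "sqrt (2 - sqrt 2) \<le> 4 / 5"
  proof (rule real_le_lsqrt)
    \<comment> \<open>The constant is 2 - (4/5)^2, and its square 1156/625 is below 2.\<close>
    have "34 / 25 \<le> sqrt 2" by (rule real_le_rsqrt) (simp add: power2_eq_square)
    then show "2 - sqrt 2 \<le> (4 / 5)\<^sup>2" by (simp add: power2_eq_square)
  qed simp
  moreover have "ereal (4 / 5) \<le> critical_radius NN p"
    unfolding critical_radius_def using percolation_prob_NN_small[OF assms]
    by (intro SUP_upper) simp
  ultimately have "ereal (sqrt (2 - sqrt 2)) \<le> critical_radius NN p"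
    by (meson ereal_less_eq(3) order_trans)
  then show ?thesis
    using assms by (simp add: critical_radius_le min_radius_CN_le_critical_radius)
qed

end
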